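(* Let $F$ be a holomorphic quadratic form on $\mathbf{C}^{2n}_{x,\xi}$ such that the fundamental matrix $\mathcal{F}$ of $F$ does not have the eigenvalues $\pm 2$, and let $\ell$ be a complex linear form on $\mathbf{C}^{2n}$. Let $\Phi_0$ be a strictly plurisubharmonic quadratic form on $\mathbf{C}^n$. Let $a(x,\xi) = \exp(i(F(x,\xi) + \ell(x,\xi)))$ and assume that $a \in L^{\infty}(\Lambda_{\Phi_0})$. Then the operator $a^w(x,D_x): H_{\Phi_0}(\mathbf{C}^n) \rightarrow H_{\Phi_0}(\mathbf{C}^n)$ is bounded.
   Context: The fundamental matrix of $F$ is $\mathcal{F}= \begin{pmatrix}F''_{\xi x} &F''_{\xi \xi }\\ -F''_{xx} &-F''_{x\xi }\end{pmatrix}$, so that the Hamilton vector field of $F$ is $H_F(\rho)=\mathcal{F}\rho$. $\Lambda_{\Phi_0} = \{(x,\frac{2}{i}\frac{\partial \Phi_0}{\partial x}(x)) : x\in \mathbf{C}^n\}$ and $H_{\Phi_0}(\mathbf{C}^n) = L^2(\mathbf{C}^n, e^{-2\Phi_0} L(dx)) \cap \mathrm{Hol}(\mathbf{C}^n)$. The Weyl quantization acting on $H_{\Phi_0}$ is $a^w(x,D_x)u(x) = (2\pi)^{-n}\iint e^{i(x-y)\cdot\theta} a(\frac{x+y}{2},\theta)u(y)\,dy\,d\theta$, the integration taken over the contour $\theta=\frac{2}{i}\frac{\partial\Phi_0}{\partial x}(\frac{x+y}{2})$ (so the operator is a metaplectic Fourier integral operator in the complex domain); boundedness means it extends from its natural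 dense domain to a bounded operator on $H_{\Phi_0}(\mathbf{C}^n)$. *)

theory Defs
  imports "HOL-Analysis.Analysis"
begin

definition bil :: "complex^'n \<Rightarrow> complex^'n \<Rightarrow> complex" where
  "bil x y = (\<Sum>i\<in>UNIV. x$i * y$i)"

definition dz :: "(complex^'n \<Rightarrow> complex) \<Rightarrow> complex^'n \<Rightarrow> 'n \<Rightarrow> complex" where
  "dz f x k = (frechet_derivative f (at x) (axis k 1)
               - \<i> * frechet_derivative f (at x) (axis k \<i>)) / 2"

definition dzbar :: "(complex^'n \<Rightarrow> complex) \<Rightarrow> complex^'n \<Rightarrow> 'n \<Rightarrow> complex" where
  "dzbar f x k = (frechet_derivative f (at x) (axis k 1)
               + \<i> * frechet_derivative f (at x) (axis k \<i>)) / 2"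

definition holo_n :: "(complex^'n \<Rightarrow> complex) \<Rightarrow> bool" where
  "holo_n u \<longleftrightarrow> (\<forall>x. \<exists>D. (u has_derivative D) (at x) \<and> (\<forall>v. D (\<i> *s v) = \<i> * D v))"

definition real_quadratic_form :: "(complex^'n \<Rightarrow> real) \<Rightarrow> bool" where
  "real_quadratic_form \<Phi> \<longleftrightarrow> (\<exists>Q. bilinear Q \<and> (\<forall>x. \<Phi> x = Q x x))"

definition strictly_psh :: "(complex^'n \<Rightarrow> real) \<Rightarrow> bool" where
  "strictly_psh \<Phi> \<longleftrightarrow> (\<forall>x w. w \<noteq> 0 \<longrightarrow>
     Re (\<Sum>j\<in>UNIV. \<Sum>k\<in>UNIV.
        dzbar (\<lambda>y. dz (\<lambda>z. complex_of_real (\<Phi> z)) y j) x k * w$j * cnj (w$k)) > 0)"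

text \<open>Fundamental matrix of F(x,xi) with Hessian blocks F''_xx = A, F''_x xi = B, F''_xi xi = C
  (so F''_xi x = transpose B):  [[F''_xi x, F''_xi xi], [-F''_xx, -F''_x xi]].\<close>
definition fundamental_matrix ::
  "complex^'n^'n \<Rightarrow> complex^'n^'n \<Rightarrow> complex^'n^'n \<Rightarrow> complex^('n + 'n)^('n + 'n)" where
  "fundamental_matrix A B C = (\<chi> i j. (case i of
      Inl p \<Rightarrow> (case j of Inl q \<Rightarrow> transpose B $ p $ q | Inr q \<Rightarrow> C $ p $ q)
    | Inr p \<Rightarrow> (case j of Inl q \<Rightarrow> - (A $ p $ q) | Inr q \<Rightarrow> - (B $ p $ q))))"

definition is_eigenvalue :: "complex^'m^'m \<Rightarrow> complex \<Rightarrow> bool" where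
  "is_eigenvalue M c \<longleftrightarrow> (\<exists>v. v \<noteq> 0 \<and> M *v v = c *s v)"

definition lam :: "(complex^'n \<Rightarrow> real) \<Rightarrow> complex^'n \<Rightarrow> (complex^'n) \<times> (complex^'n)" where
  "lam \<Phi> x = (x, (2 / \<i>) *s (\<chi> k. dz (\<lambda>z. complex_of_real (\<Phi> z)) x k))"

definition H_space :: "(complex^'n \<Rightarrow> real) \<Rightarrow> (complex^'n \<Rightarrow> complex) \<Rightarrow> bool" where
  "H_space \<Phi> u \<longleftrightarrow> holo_n u \<and>
     (\<integral>\<^sup>+ x. ennreal ((cmod (u x))^2 * exp (- 2 * \<Phi> x)) \<partial>lborel) < \<infinity>"

definition H_norm :: "(complex^'n \<Rightarrow> real) \<Rightarrow> (complex^'n \<Rightarrow> complex) \<Rightarrow> real" where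
  "H_norm \<Phi> u = sqrt (enn2real (\<integral>\<^sup>+ x. ennreal ((cmod (u x))^2 * exp (- 2 * \<Phi> x)) \<partial>lborel))"

definition theta :: "(complex^'n \<Rightarrow> real) \<Rightarrow> complex^'n \<Rightarrow> complex^'n \<Rightarrow> complex^'n" where
  "theta \<Phi> x y = (2 / \<i>) *s (\<chi> k. dz (\<lambda>z. complex_of_real (\<Phi> z)) ((1/2::real) *\<^sub>R (x + y)) k)"

text \<open>Density of the pullback of dy_1..dy_n dtheta_1..dtheta_n along y |-> (y, theta(y)) with
  respect to Lebesgue measure L(dy) (standard orientation of C^n):
  dtheta = P dy + Q dybar, so dy ^ dtheta = det Q dy ^ dybar = (-1)^(n(n-1)/2) (-2i)^n det Q L(dy).\<close>
definition contour_jac :: "(complex^'n \<Rightarrow> real) \<Rightarrow> complex^'n \<Rightarrow> complex^'n \<Rightarrow> complex" where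
  "contour_jac \<Phi> x y = (let n = CARD('n) in
     (-1) ^ (n * (n - 1) div 2) * (- 2 * \<i>) ^ n *
     det (\<chi> j k. dzbar (\<lambda>z. theta \<Phi> x z $ j) y k))"

definition weyl :: "((complex^'n) \<times> (complex^'n) \<Rightarrow> complex) \<Rightarrow> (complex^'n \<Rightarrow> real)
     \<Rightarrow> (complex^'n \<Rightarrow> complex) \<Rightarrow> complex^'n \<Rightarrow> complex" where
  "weyl a \<Phi> u x = complex_of_real ((1 / (2 * pi)) ^ CARD('n)) *
     (\<integral> y. exp (\<i> * bil (x - y) (theta \<Phi> x y))
            * a ((1/2::real) *\<^sub>R (x + y), theta \<Phi> x y) * u y * contour_jac \<Phi> x y \<partial>lborel)"

text \<open>Natural dense domain: elements of H_Phi with u e^{-Phi} in L^1, on which the integral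
  defining weyl converges absolutely when a is bounded on Lambda_Phi.\<close>
definition weyl_dom :: "(complex^'n \<Rightarrow> real) \<Rightarrow> (complex^'n \<Rightarrow> complex) \<Rightarrow> bool" where
  "weyl_dom \<Phi> u \<longleftrightarrow> H_space \<Phi> u \<and> integrable lborel (\<lambda>y. cmod (u y) * exp (- \<Phi> y))"

end

(* Writing 2 Phi0 = N + Re P with N the (positive definite) Levi form and P holomorphic, the gauge
   factor exp(-P/2) turns the Weyl operator into an operator on the Fock space with weight exp(-N)
   whose symbol is a Gaussian exp g with Re g bounded above.  Inserting the reproducing formula makes
   its kernel a convergent complex Gaussian integral.  Completing the square at the complex critical
   point s + i t of the exponent gives the size of the normalised kernel at (x, w) as exp k with
     -2 k = 4 N(t) + N(2 s - x - w) - 2 Re g(s) - 2 Re g2(t),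
   g2 being the quadratic part of g.  So k is bounded above, and it is a quadratic polynomial whose
   quadratic part is strictly negative in x alone and in w alone: a zero in w (or x) would produce a
   vector of the totally real graph which is an eigenvector of the fundamental matrix for the
   eigenvalue 2 (or -2).  Hence exp k satisfies Schur's test. *)
theory Submission
  imports Defs "HOL-Probability.Distributions" "HOL-Complex_Analysis.Conformal_Mappings"
begin

text \<open>Taking absolute values in the Weyl integral cannot work: on the contour Re (i (x - y) .
  theta) = Phi0 x - Phi0 y, so the weighted kernel has modulus a constant times |a|, which need not
  decay. Decay has to come from the holomorphy of u, and the reproducing formula is where it enters.
  Even then the exponent k is in general not negative definite in (x, w) jointly: for a = 1 it is -
  N(x - w) / 2.

  The critical point is complex because the exponent is a complex valued quadratic polynomial on C^n
  seen as a real space of dimension 2n; s and t both lie in that real space. Hence the bound for a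
  on the graph can be used at both: at s for the whole of g, at t for its quadratic part, whose real
  part is nonpositive because Re g is bounded above. The Gaussian integrals therefore concern forms
  that are only real bilinear, and the shift by i t is justified by analytic continuation.\<close>

section \<open>Gaussian integrals and differentiation under the integral\<close>

lemma integrable_exp_neg_square_real:
  fixes c :: real assumes "c > 0"
  shows "integrable lborel (\<lambda>x::real. exp (- (c * x^2)))"
proof -
  define s where "s = sqrt (1 / (2 * c))"
  have s: "s > 0" "s\<^sup>2 = 1 / (2 * c)" using assms by (auto simp: s_def)
  have "integrable lborel (\<lambda>x. sqrt (2 * pi * s\<^sup>2) * normal_density 0 s x)"
    by (intro integrable_mult_right integrable_normal_density s)
  moreover have "sqrt (2 * pi * s\<^sup>2) * normal_density 0 s x = exp (- (c * x^2))" for x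
    unfolding normal_density_def using s assms by (simp add: field_simps)
  ultimately show ?thesis by simp
qed

lemma integrable_exp_neg_norm_square:
  fixes c :: real assumes "c > 0"
  shows "integrable lborel (\<lambda>x::'a::euclidean_space. exp (- (c * (norm x)^2)))"
proof (rule integrableI_bounded)
  show "(\<lambda>x::'a. exp (- (c * (norm x)^2))) \<in> borel_measurable lborel" by measurable
  have "(\<integral>\<^sup>+x. ennreal (norm (exp (- (c * (norm (x::'a))^2)))) \<partial>lborel)
      = (\<integral>\<^sup>+x. (\<Prod>b\<in>(Basis::'a set). ennreal (exp (- (c * (x \<bullet> b)^2)))) \<partial>lborel)"
  proof (intro nn_integral_cong)
    fix x :: 'a
    have "(norm x)^2 = (\<Sum>b\<in>Basis. (x \<bullet> b)^2)"
      by (simp add: norm_eq_sqrt_inner euclidean_inner[of x x] power2_eq_square sum_nonneg)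
    then show "ennreal (norm (exp (- (c * (norm x)^2)))) = (\<Prod>b\<in>Basis. ennreal (exp (- (c * (x \<bullet> b)^2))))"
      by (simp add: prod_ennreal exp_sum sum_distrib_left sum_negf[symmetric] prod_nonneg)
  qed
  also have "\<dots> = (\<Prod>b\<in>(Basis::'a set). (\<integral>\<^sup>+x. ennreal (exp (- (c * x^2))) \<partial>lborel))"
    by (subst nn_integral_lborel_prod[symmetric]) auto
  also have "\<dots> < \<infinity>"
    using integrable_exp_neg_square_real[OF assms]
    by (simp add: real_integrable_def less_top[symmetric] ennreal_prod_eq_top power_eq_top_ennreal)
  finally show "(\<integral>\<^sup>+x. ennreal (norm (exp (- (c * (norm (x::'a))^2)))) \<partial>lborel) < \<infinity>" .
qed

lemma linear_le_quadratic:
  fixes a c t :: real assumes "c > 0"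
  shows "a * t \<le> c * t^2 + a^2 / (4 * c)"
proof -
  have "0 \<le> (2 * c * t - a)^2 / (4 * c)" using assms by simp
  also have "\<dots> = c * t^2 + a^2 / (4 * c) - a * t"
    using assms by (simp add: field_simps power2_eq_square)
  finally show ?thesis by simp
qed

lemma integrable_gaussian_linear:
  fixes c a :: real assumes "c > 0"
  shows "integrable lborel (\<lambda>x::'a::euclidean_space. exp (a * norm x - c * (norm x)^2))"
proof (rule Bochner_Integration.integrable_bound)
  show "integrable lborel (\<lambda>x::'a. exp (a^2 / (2*c)) * exp (- ((c/2) * (norm x)^2)))"
    by (intro integrable_mult_right integrable_exp_neg_norm_square) (use assms in auto)
  show "AE x::'a in lborel. norm (exp (a * norm x - c * (norm x)^2)) \<le> norm (exp (a^2 / (2*c)) * exp (- ((c/2) * (norm x)^2)))"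
  proof (intro AE_I2)
    fix x :: 'a
    show "norm (exp (a * norm x - c * (norm x)^2)) \<le> norm (exp (a^2 / (2*c)) * exp (- ((c/2) * (norm x)^2)))"
      using linear_le_quadratic[of "c/2" a "norm x"] assms by (simp add: mult_exp_exp)
  qed
qed measurable

text \<open>The difference quotients are dominated by \<open>2 * B\<close> through the mean value
  inequality on the ball, so dominated convergence applies along every sequence tending to 0. The
  Frechet form, rather than one direction at a time, is what \<open>holo_n\<close> asks for.\<close>

lemma has_derivative_integral_dominated:
  fixes f :: "'a::real_normed_vector \<Rightarrow> 'b \<Rightarrow> 'c::{banach, second_countable_topology}"
  assumes r: "r > 0"
    and int: "\<And>x. x \<in> ball x0 r \<Longrightarrow> integrable M (f x)"
    and der: "\<And>x y. x \<in> ball x0 r \<Longrightarrow> y \<in> space M \<Longrightarrow> ((\<lambda>x. f x y) has_derivative D x y) (at x)"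
    and bnd: "\<And>x y h. x \<in> ball x0 r \<Longrightarrow> y \<in> space M \<Longrightarrow> norm (D x y h) \<le> B y * norm h"
    and B: "integrable M B"
    and meas: "\<And>h. (\<lambda>y. D x0 y h) \<in> borel_measurable M"
  shows "((\<lambda>x. \<integral>y. f x y \<partial>M) has_derivative (\<lambda>h. \<integral>y. D x0 y h \<partial>M)) (at x0)"
proof -
  have x0: "x0 \<in> ball x0 r" using r by simp
  have lin: "bounded_linear (D x0 y)" if "y \<in> space M" for y
    using der[OF x0 that] by (rule has_derivative_bounded_linear)
  have intD: "integrable M (\<lambda>y. D x0 y h)" for h
    by (rule Bochner_Integration.integrable_bound[of M "\<lambda>y. B y * norm h"])
       (use B meas bnd[OF x0] in \<open>auto intro!: AE_I2 order_trans[OF bnd[OF x0]] abs_ge_self\<close>)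
  show ?thesis
    unfolding has_derivative_at
  proof
    show "bounded_linear (\<lambda>h. \<integral>y. D x0 y h \<partial>M)"
    proof (rule bounded_linear_intro[where K="\<integral>y. B y \<partial>M"])
      fix h k :: 'a and c :: real
      show "(\<integral>y. D x0 y (h + k) \<partial>M) = (\<integral>y. D x0 y h \<partial>M) + (\<integral>y. D x0 y k \<partial>M)"
        using lin by (subst Bochner_Integration.integral_add[symmetric])
          (auto intro!: intD Bochner_Integration.integral_cong simp: linear_simps)
      show "(\<integral>y. D x0 y (c *\<^sub>R h) \<partial>M) = c *\<^sub>R (\<integral>y. D x0 y h \<partial>M)"
      proof -
        have "(\<integral>y. D x0 y (c *\<^sub>R h) \<partial>M) = (\<integral>y. c *\<^sub>R D x0 y h \<partial>M)"
          using lin by (intro Bochner_Integration.integral_cong) (auto simp: linear_simps)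
        then show ?thesis by simp
      qed
      have "norm (\<integral>y. D x0 y h \<partial>M) \<le> (\<integral>y. B y * norm h \<partial>M)"
        by (intro order_trans[OF integral_norm_bound] integral_mono) (use intD B bnd[OF x0] in auto)
      then show "norm (\<integral>y. D x0 y h \<partial>M) \<le> norm h * (\<integral>y. B y \<partial>M)"
        by (simp add: mult.commute)
    qed
    show "(\<lambda>h. norm ((\<integral>y. f (x0 + h) y \<partial>M) - (\<integral>y. f x0 y \<partial>M) - (\<integral>y. D x0 y h \<partial>M)) / norm h) \<midarrow>0\<rightarrow> 0"
    proof (rule iffD2[OF tendsto_at_iff_sequentially], intro allI impI)
      fix X :: "nat \<Rightarrow> 'a" assume X: "\<forall>i. X i \<in> UNIV - {0}" "X \<longlonglongrightarrow> 0"
      have "eventually (\<lambda>n. norm (X n) < r) sequentially"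
        using tendsto_norm[OF X(2)] r by (auto simp: order_tendsto_iff)
      then obtain n0 where n0: "\<And>n. n \<ge> n0 \<Longrightarrow> norm (X n) < r"
        by (auto simp: eventually_sequentially)
      \<comment> \<open>Dropping finitely many terms puts every \<open>x0 + Y n\<close> into the
        ball where the hypotheses hold.\<close>
      define Y where "Y n = X (n + n0)" for n
      have Y: "Y n \<noteq> 0" "x0 + Y n \<in> ball x0 r" for n
        using X(1) n0 by (auto simp: Y_def dist_norm)
      have Y0: "Y \<longlonglongrightarrow> 0" unfolding Y_def using X(2) by (rule LIMSEQ_ignore_initial_segment)
      define q where "q n y = norm (f (x0 + Y n) y - f x0 y - D x0 y (Y n)) / norm (Y n)" for n y
      have q_le: "q n y \<le> 2 * B y" if y: "y \<in> space M" for n y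
      proof -
        have "norm (f (x0 + Y n) y - f x0 y) \<le> B y * norm ((x0 + Y n) - x0)"
        proof (rule differentiable_bound[of "ball x0 r" "\<lambda>x. f x y" "\<lambda>x. D x y"])
          \<comment> \<open>\<open>onorm_bound\<close> wants \<open>0 \<le> B y\<close>; this
            follows from the bound on the derivative at the nonzero vector
            \<open>Y n\<close>.\<close>
          show "onorm (D x y) \<le> B y" if "x \<in> ball x0 r" for x
            by (rule onorm_bound)
              (use bnd[OF that y] bnd[OF x0 y, of "Y n"] Y(1)[of n] in
               \<open>auto intro: order_trans[OF norm_ge_zero] simp: zero_le_mult_iff dest!: order_trans[OF norm_ge_zero]\<close>)
        qed (use der y Y x0 in \<open>auto intro: has_derivative_at_withinI\<close>)
        then have "norm (f (x0 + Y n) y - f x0 y - D x0 y (Y n)) \<le> B y * norm (Y n) + B y * norm (Y n)"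
          using bnd[OF x0 y, of "Y n"] norm_triangle_ineq4[of "f (x0 + Y n) y - f x0 y" "D x0 y (Y n)"]
          by simp
        then show ?thesis using Y(1)[of n] by (simp add: q_def field_simps)
      qed
      have qm: "q n \<in> borel_measurable M" for n
        unfolding q_def using int[OF Y(2)[of n]] int[OF x0] meas by measurable
      have lim: "(\<lambda>n. \<integral>y. q n y \<partial>M) \<longlonglongrightarrow> (\<integral>y. 0 \<partial>M)"
      proof (rule integral_dominated_convergence[where w="\<lambda>y. 2 * B y"])
        show "AE y in M. (\<lambda>n. q n y) \<longlonglongrightarrow> 0"
        proof (rule AE_I2)
          fix y assume y: "y \<in> space M"
          have "(\<lambda>h. norm (f (x0 + h) y - f x0 y - D x0 y h) / norm h) \<midarrow>0\<rightarrow> 0"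
            using der[OF x0 y] by (simp add: has_derivative_at)
          then show "(\<lambda>n. q n y) \<longlonglongrightarrow> 0"
            unfolding tendsto_at_iff_sequentially q_def using Y Y0 by (auto simp: o_def)
        qed
        show "AE y in M. norm (q n y) \<le> 2 * B y" for n
          using q_le[of _ n] by (intro AE_I2) (auto simp: q_def)
      qed (use qm B in auto)
      have "(\<lambda>n. norm ((\<integral>y. f (x0 + Y n) y \<partial>M) - (\<integral>y. f x0 y \<partial>M) - (\<integral>y. D x0 y (Y n) \<partial>M)) / norm (Y n)) \<longlonglongrightarrow> 0"
      proof (rule tendsto_sandwich[OF _ _ tendsto_const])
        show "(\<lambda>n. \<integral>y. q n y \<partial>M) \<longlonglongrightarrow> 0" using lim by simp
        show "\<forall>\<^sub>F n in sequentially. norm ((\<integral>y. f (x0 + Y n) y \<partial>M) - (\<integral>y. f x0 y \<partial>M) - (\<integral>y. D x0 y (Y n) \<partial>M)) / norm (Y n)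
            \<le> (\<integral>y. q n y \<partial>M)"
        proof (intro always_eventually allI)
          fix n
          have "(\<integral>y. f (x0 + Y n) y \<partial>M) - (\<integral>y. f x0 y \<partial>M) - (\<integral>y. D x0 y (Y n) \<partial>M)
             = (\<integral>y. f (x0 + Y n) y - f x0 y - D x0 y (Y n) \<partial>M)"
            using int[OF Y(2)[of n]] int[OF x0] intD by simp
          also have "norm \<dots> / norm (Y n) \<le> (\<integral>y. norm (f (x0 + Y n) y - f x0 y - D x0 y (Y n)) \<partial>M) / norm (Y n)"
            by (intro divide_right_mono integral_norm_bound) auto
          finally show "norm ((\<integral>y. f (x0 + Y n) y \<partial>M) - (\<integral>y. f x0 y \<partial>M) - (\<integral>y. D x0 y (Y n) \<partial>M)) / norm (Y n)
            \<le> (\<integral>y. q n y \<partial>M)" by (simp add: q_def)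
        qed
      qed auto
      then have "((\<lambda>h. norm ((\<integral>y. f (x0 + h) y \<partial>M) - (\<integral>y. f x0 y \<partial>M) - (\<integral>y. D x0 y h \<partial>M)) / norm h) \<circ> X) \<longlonglongrightarrow> 0"
        unfolding Y_def o_def by (rule LIMSEQ_offset)
      then show "((\<lambda>h. norm ((\<integral>y. f (x0 + h) y \<partial>M) - (\<integral>y. f x0 y \<partial>M) - (\<integral>y. D x0 y h \<partial>M)) / norm h) \<circ> X) \<longlonglongrightarrow> 0" .
    qed
  qed
qed

section \<open>Isometries and Lebesgue measure\<close>

lemma nn_integral_lborel_affine:
  fixes f :: "'a::euclidean_space \<Rightarrow> ennreal"
  assumes [measurable]: "f \<in> borel_measurable borel" and "c \<noteq> 0"
  shows "(\<integral>\<^sup>+x. f x \<partial>lborel) = ennreal (\<bar>c\<bar> ^ DIM('a)) * (\<integral>\<^sup>+x. f (t + c *\<^sub>R x) \<partial>lborel)"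
  by (subst lborel_affine[OF assms(2), of t])
     (simp add: nn_integral_density nn_integral_distr nn_integral_cmult ennreal_power)

lemma integral_lborel_affine:
  fixes f :: "'a::euclidean_space \<Rightarrow> 'b::{banach, second_countable_topology}"
  assumes [measurable]: "f \<in> borel_measurable borel" and "c \<noteq> 0"
  shows "(\<integral>x. f x \<partial>lborel) = (\<bar>c\<bar> ^ DIM('a)) *\<^sub>R (\<integral>x. f (t + c *\<^sub>R x) \<partial>lborel)"
  by (subst lborel_affine[OF assms(2), of t])
     (simp add: integral_density integral_distr)

lemma integrable_lborel_affine:
  fixes f :: "'a::euclidean_space \<Rightarrow> 'b::{banach, second_countable_topology}"
  assumes [measurable]: "f \<in> borel_measurable borel" and "c \<noteq> 0" "integrable lborel f"
  shows "integrable lborel (\<lambda>x. f (t + c *\<^sub>R x))"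
proof -
  have "integrable (density (distr lborel borel (\<lambda>x. t + c *\<^sub>R x)) (\<lambda>_. ennreal (\<bar>c\<bar> ^ DIM('a)))) f"
    using assms(3) by (subst (asm) lborel_affine[OF assms(2), of t])
  then have "integrable lborel (\<lambda>x. \<bar>c\<bar> ^ DIM('a) *\<^sub>R f (t + c *\<^sub>R x))"
    by (simp add: integrable_density integrable_distr_eq)
  then show ?thesis
    using integrable_scaleR_right[of "inverse (\<bar>c\<bar> ^ DIM('a))"] assms(2) by fastforce
qed

text \<open>Finite and nonzero, so that a Gaussian factor can be cancelled in the isometry argument
  below.\<close>

lemma nn_integral_exp_neg_norm_square:
  "(\<integral>\<^sup>+x. ennreal (exp (- (norm (x::'a::euclidean_space))\<^sup>2)) \<partial>lborel) \<noteq> \<infinity>"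
  "(\<integral>\<^sup>+x. ennreal (exp (- (norm (x::'a::euclidean_space))\<^sup>2)) \<partial>lborel) \<noteq> 0"
proof -
  show "(\<integral>\<^sup>+x. ennreal (exp (- (norm (x::'a))\<^sup>2)) \<partial>lborel) \<noteq> \<infinity>"
    using integrable_exp_neg_norm_square[of 1, where ?'a='a] by (simp add: real_integrable_def)
  show "(\<integral>\<^sup>+x. ennreal (exp (- (norm (x::'a))\<^sup>2)) \<partial>lborel) \<noteq> 0"
  proof
    assume "(\<integral>\<^sup>+x. ennreal (exp (- (norm (x::'a))\<^sup>2)) \<partial>lborel) = 0"
    then have "AE x in (lborel :: 'a measure). False"
      by (subst (asm) nn_integral_0_iff_AE) (auto simp: not_le)
    then show False
      using emeasure_lborel_UNIV[where 'a='a] by (simp add: AE_iff_null null_sets_def)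
  qed
qed

text \<open>Uniqueness of translation-invariant measures: both measures are compared by integrating
  \<open>f x * g y\<close> over the product, where \<open>g\<close> is the Gaussian, which the isometry leaves unchanged.\<close>
lemma nn_integral_lborel_isometry:
  fixes T :: "'a::euclidean_space \<Rightarrow> 'a" and f :: "'a \<Rightarrow> ennreal"
  assumes T: "linear T" "\<And>x. norm (T x) = norm x" and f[measurable]: "f \<in> borel_measurable borel"
  shows "(\<integral>\<^sup>+x. f (T x) \<partial>lborel) = (\<integral>\<^sup>+x. f x \<partial>lborel)"
proof -
  define g where "g x = ennreal (exp (- (norm (x::'a))\<^sup>2))" for x
  have g[measurable]: "g \<in> borel_measurable borel" unfolding g_def by measurable
  have [measurable]: "T \<in> borel_measurable borel"
    using T(1) by (intro borel_measurable_continuous_onI linear_continuous_on linear_conv_bounded_linear[THEN iffD1])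
  have "inj T" unfolding linear_injective_0[OF T(1)] using T(2) by (metis norm_eq_zero)
  then have "surj T" using T(1) by (simp add: linear_inj_imp_surj)
  have gT: "g (T x) = g x" for x by (simp add: g_def T(2))
  have shift: "(\<integral>\<^sup>+x. h (t + x) \<partial>lborel) = (\<integral>\<^sup>+x. h x \<partial>lborel)"
    if "h \<in> borel_measurable borel" for h :: "'a \<Rightarrow> ennreal" and t
    using nn_integral_lborel_affine[OF that, of 1 t] by simp
  have "(\<integral>\<^sup>+x. f x \<partial>lborel) * (\<integral>\<^sup>+y. g y \<partial>lborel) = (\<integral>\<^sup>+y. (\<integral>\<^sup>+x. f x * g (T y) \<partial>lborel) \<partial>lborel)"
    by (simp add: nn_integral_multc nn_integral_cmult gT)
  also have "\<dots> = (\<integral>\<^sup>+y. (\<integral>\<^sup>+x. f (T y + x) * g (T y) \<partial>lborel) \<partial>lborel)"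
  proof (rule nn_integral_cong)
    fix y
    show "(\<integral>\<^sup>+x. f x * g (T y) \<partial>lborel) = (\<integral>\<^sup>+x. f (T y + x) * g (T y) \<partial>lborel)"
      by (subst (1 2) nn_integral_multc) (simp_all add: shift[OF f])
  qed
  also have "\<dots> = (\<integral>\<^sup>+x. (\<integral>\<^sup>+y. f (T y + x) * g (T y) \<partial>lborel) \<partial>lborel)"
    by (rule lborel_pair.Fubini') measurable
  also have "\<dots> = (\<integral>\<^sup>+x. (\<integral>\<^sup>+y. f (T y) * g (T y - x) \<partial>lborel) \<partial>lborel)"
  proof (rule nn_integral_cong)
    fix x :: 'a
    \<comment> \<open>By surjectivity the shift by \<open>x\<close> is the image of a shift by
      \<open>z\<close>, which a translation of \<open>y\<close> absorbs.\<close>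
    obtain z where z: "x = T z" using \<open>surj T\<close> by blast
    show "(\<integral>\<^sup>+y. f (T y + x) * g (T y) \<partial>lborel) = (\<integral>\<^sup>+y. f (T y) * g (T y - x) \<partial>lborel)"
      using shift[of "\<lambda>y. f (T y) * g (T y - x)" z] by (simp add: z linear_add[OF T(1)] add.commute)
  qed
  also have "\<dots> = (\<integral>\<^sup>+y. (\<integral>\<^sup>+x. f (T y) * g (T y - x) \<partial>lborel) \<partial>lborel)"
    by (rule lborel_pair.Fubini') measurable
  also have "\<dots> = (\<integral>\<^sup>+y. f (T y) * (\<integral>\<^sup>+x. g x \<partial>lborel) \<partial>lborel)"
  proof (rule nn_integral_cong)
    fix y
    show "(\<integral>\<^sup>+x. f (T y) * g (T y - x) \<partial>lborel) = f (T y) * (\<integral>\<^sup>+x. g x \<partial>lborel)"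
      using nn_integral_lborel_affine[OF g, of "-1" "T y"] by (simp add: nn_integral_cmult)
  qed
  also have "\<dots> = (\<integral>\<^sup>+x. f (T x) \<partial>lborel) * (\<integral>\<^sup>+y. g y \<partial>lborel)"
    by (simp add: nn_integral_multc)
  finally show ?thesis
    using nn_integral_exp_neg_norm_square[where 'a='a] unfolding g_def[symmetric]
    by (auto simp: mult.commute[of _ "nn_integral lborel g"] ennreal_mult_cancel_left)
qed

text \<open>Used for multiplication by a complex number of modulus one, in the Gaussian mean value
  property.\<close>

lemma distr_lborel_isometry:
  fixes T :: "'a::euclidean_space \<Rightarrow> 'a"
  assumes T: "linear T" "\<And>x. norm (T x) = norm x"
  shows "distr lborel borel T = lborel"
proof (rule measure_eqI)
  have [measurable]: "T \<in> borel_measurable borel"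
    using T(1) by (intro borel_measurable_continuous_onI linear_continuous_on linear_conv_bounded_linear[THEN iffD1])
  fix A assume "A \<in> sets (distr lborel borel T)"
  then have [measurable]: "A \<in> sets borel" by simp
  have "emeasure (distr lborel borel T) A = (\<integral>\<^sup>+x. indicator A x \<partial>distr lborel borel T)" by simp
  also have "\<dots> = (\<integral>\<^sup>+x. indicator A (T x) \<partial>lborel)" by (rule nn_integral_distr) measurable
  also have "\<dots> = (\<integral>\<^sup>+x. indicator A x \<partial>lborel)" by (rule nn_integral_lborel_isometry[OF T]) measurable
  finally show "emeasure (distr lborel borel T) A = emeasure lborel A" by simp
qed simp

section \<open>Entire functions of several variables\<close>

lemma norm_vector_smult: "norm (c *s (x::complex^'n)) = cmod c * norm x"
  by (simp add: norm_vec_def L2_set_def norm_mult power_mult_distrib sum_distrib_left[symmetric] real_sqrt_mult)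

lemma bounded_linear_smult_right: "bounded_linear (\<lambda>x::complex^'n. c *s x)"
  by (rule bounded_linear_intro[where K="cmod c"])
     (auto simp: vec_eq_iff algebra_simps norm_vector_smult)

lemma bounded_linear_smult_left: "bounded_linear (\<lambda>c. c *s (x::complex^'n))"
  by (rule bounded_linear_intro[where K="norm x"])
     (auto simp: vec_eq_iff algebra_simps norm_vector_smult)

lemma smult_Re_Im: "c *s (x::complex^'n) = Re c *\<^sub>R x + Im c *\<^sub>R (\<i> *s x)"
  by (simp add: vec_eq_iff complex_eq_iff)

lemma complex_linear_smult:
  assumes D: "linear D" and i: "\<And>x. D (\<i> *s (x::complex^'n)) = \<i> * D x"
  shows "D (c *s x) = c * D x"
proof -
  have "D (c *s x) = Re c *\<^sub>R D x + Im c *\<^sub>R D (\<i> *s x)"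
    by (subst smult_Re_Im) (simp add: linear_add[OF D] linear_scale[OF D])
  then show ?thesis by (simp add: i complex_eq_iff)
qed

lemma holo_n_D:
  assumes "holo_n u"
  shows "\<exists>D. (u has_derivative D) (at x) \<and> (\<forall>v. D (\<i> *s v) = \<i> * D v) \<and> (\<forall>c v. D (c *s v) = c * D v)"
proof -
  from assms have "\<exists>D. (u has_derivative D) (at x) \<and> (\<forall>v. D (\<i> *s v) = \<i> * D v)"
    unfolding holo_n_def by (rule spec)
  then obtain D where D: "(u has_derivative D) (at x)" "\<And>v. D (\<i> *s v) = \<i> * D v"
    by auto
  have "linear D" using D(1) by (rule has_derivative_linear)
  then have "D (c *s v) = c * D v" for c v by (rule complex_linear_smult) (rule D(2))
  with D show ?thesis by auto
qed

lemma holo_n_I: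
  assumes "\<And>x. (u has_derivative D x) (at x)" "\<And>x v. D x (\<i> *s v) = \<i> * D x v"
  shows "holo_n u"
  using assms unfolding holo_n_def by blast

lemma holo_n_continuous:
  assumes "holo_n u" shows "continuous_on S u"
proof (rule continuous_at_imp_continuous_on, rule ballI)
  fix x
  obtain D where D: "(u has_derivative D) (at x)" "\<And>v. D (\<i> *s v) = \<i> * D v"
      "\<And>c v. D (c *s v) = c * D v" using holo_n_D[OF assms, of "x"] by auto
  show "isCont u x" using D(1) by (rule has_derivative_continuous)
qed

lemma holo_n_measurable: "holo_n u \<Longrightarrow> u \<in> borel_measurable borel"
  by (intro borel_measurable_continuous_onI holo_n_continuous)

lemma holo_n_mult:
  assumes "holo_n u" "holo_n v" shows "holo_n (\<lambda>x. u x * v x)"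
  unfolding holo_n_def
proof
  fix x
  obtain D where D: "(u has_derivative D) (at x)" "\<And>v. D (\<i> *s v) = \<i> * D v"
      "\<And>c v. D (c *s v) = c * D v"
    using holo_n_D[OF assms(1), of "x"] by auto
  obtain E where E: "(v has_derivative E) (at x)" "\<And>v. E (\<i> *s v) = \<i> * E v"
      "\<And>c v. E (c *s v) = c * E v"
    using holo_n_D[OF assms(2), of "x"] by auto
  show "\<exists>D. ((\<lambda>x. u x * v x) has_derivative D) (at x) \<and> (\<forall>v. D (\<i> *s v) = \<i> * D v)"
    by (intro exI conjI, rule has_derivative_mult[OF D(1) E(1)]) (simp add: D E algebra_simps)
qed

lemma holo_n_const: "holo_n (\<lambda>x. c)"
  by (rule holo_n_I[where D="\<lambda>_ _. 0"]) auto

lemma holo_n_exp: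
  assumes "holo_n u" shows "holo_n (\<lambda>x. exp (u x))"
  unfolding holo_n_def
proof
  fix x
  obtain D where D: "(u has_derivative D) (at x)" "\<And>v. D (\<i> *s v) = \<i> * D v"
      "\<And>c v. D (c *s v) = c * D v"
    using holo_n_D[OF assms(1), of "x"] by auto
  have "((\<lambda>x. exp (u x)) has_derivative (\<lambda>h. exp (u x) * D h)) (at x)"
    by (rule has_derivative_eq_rhs[OF has_derivative_compose[OF D(1), of exp "(*) (exp (u x))"]])
       (use DERIV_exp[of "u x"] in \<open>auto simp: has_field_derivative_def\<close>)
  then show "\<exists>D. ((\<lambda>x. exp (u x)) has_derivative D) (at x) \<and> (\<forall>v. D (\<i> *s v) = \<i> * D v)"
    by (intro exI conjI, assumption) (simp add: D)
qed

lemma holo_n_translate: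
  assumes "holo_n u" shows "holo_n (\<lambda>x. u (x + c))"
  unfolding holo_n_def
proof
  fix x
  obtain D where D: "(u has_derivative D) (at (x + c))" "\<And>v. D (\<i> *s v) = \<i> * D v"
      "\<And>c v. D (c *s v) = c * D v"
    using holo_n_D[OF assms(1), of "x + c"] by auto
  have "((\<lambda>x. u (x + c)) has_derivative D) (at x)"
  proof -
    have "((\<lambda>x. x + c) has_derivative (\<lambda>h. h)) (at x)"
      by (auto intro!: derivative_eq_intros)
    from has_derivative_compose[OF this D(1)] show ?thesis .
  qed
  then show "\<exists>D. ((\<lambda>x. u (x + c)) has_derivative D) (at x) \<and> (\<forall>v. D (\<i> *s v) = \<i> * D v)"
    using D(2) by blast
qed

lemma holo_n_linear:
  assumes "bounded_linear D" "\<And>v. D (\<i> *s v) = \<i> * D v"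
  shows "holo_n D"
  by (rule holo_n_I[where D="\<lambda>_. D"]) (use assms in \<open>auto intro: bounded_linear_imp_has_derivative\<close>)

lemma holo_n_quadratic:
  assumes B: "bounded_bilinear B"
    and "\<And>x y. B (\<i> *s x) y = \<i> * B x y" "\<And>x y. B x (\<i> *s y) = \<i> * B x y"
  shows "holo_n (\<lambda>x. B x x)"
proof (rule holo_n_I)
  show "((\<lambda>x. B x x) has_derivative (\<lambda>h. B x h + B h x)) (at x)" for x
    by (rule bounded_bilinear.FDERIV[OF B has_derivative_ident has_derivative_ident])
qed (use assms in \<open>auto simp: algebra_simps\<close>)

text \<open>On the complex line through \<open>w\<close> the function is entire in one variable, so
  this is Cauchy's formula at the centre of the unit circle, parametrised by the angle
  \<open>2 * pi * t\<close>.\<close>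

lemma holo_n_circle_mean:
  fixes v :: "complex^'n \<Rightarrow> complex"
  assumes v: "holo_n v"
  shows "(\<integral>t. indicator {0..1::real} t *\<^sub>R v (exp (2 * of_real pi * \<i> * of_real t) *s w) \<partial>lborel) = v 0"
proof -
  define f where "f \<zeta> = v (\<zeta> *s w)" for \<zeta>
  have der: "\<exists>d. (f has_field_derivative d) (at \<zeta>)" for \<zeta>
  proof -
    obtain D where D: "(v has_derivative D) (at (\<zeta> *s w))" "\<And>v. D (\<i> *s v) = \<i> * D v"
      "\<And>c v. D (c *s v) = c * D v"
      using holo_n_D[OF v, of "\<zeta> *s w"] by auto
    have "(f has_derivative (\<lambda>h. D (h *s w))) (at \<zeta>)"
      unfolding f_def
      by (rule has_derivative_compose[OF bounded_linear_imp_has_derivative[OF bounded_linear_smult_left] D(1)])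
    moreover have "(\<lambda>h. D (h *s w)) = (*) (D w)"
      by (rule ext) (simp add: D(3))
    ultimately have "(f has_field_derivative D w) (at \<zeta>)"
      by (simp only: has_field_derivative_def)
    then show ?thesis by blast
  qed
  have fh: "f holomorphic_on UNIV"
    unfolding holomorphic_on_def field_differentiable_def using der by blast
  define e where "e t = exp (2 * of_real pi * \<i> * complex_of_real t)" for t
  define k where "k = 2 * of_real pi * \<i>"
  have "k \<noteq> 0" by (simp add: k_def)
  have "((\<lambda>u. f u / (u - 0)) has_contour_integral (2 * of_real pi * \<i> * f 0)) (circlepath 0 1)"
    by (rule Cauchy_integral_circlepath_simple[OF holomorphic_on_subset[OF fh]]) auto
  then have "((\<lambda>t. f (circlepath 0 1 t) / circlepath 0 1 t * vector_derivative (circlepath 0 1) (at t within {0..1}))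
        has_integral (2 * of_real pi * \<i> * f 0)) {0..1}"
    by (simp only: has_contour_integral_def diff_zero)
  then have "((\<lambda>t. (2 * of_real pi * \<i>) * f (exp (2 * of_real pi * \<i> * of_real t)))
        has_integral (2 * of_real pi * \<i> * f 0)) {0..1}"
  proof (rule has_integral_eq[rotated])
    fix t :: real assume t: "t \<in> {0..1}"
    have "circlepath 0 1 t = exp (2 * of_real pi * \<i> * of_real t)" by (simp add: circlepath)
    moreover have "vector_derivative (circlepath 0 1) (at t within {0..1})
        = 2 * of_real pi * \<i> * exp (2 * of_real pi * \<i> * of_real t)"
      using t vector_derivative_circlepath01[of t 0 1] by (simp only: atLeastAtMost_iff) simp
    ultimately show "f (circlepath 0 1 t) / circlepath 0 1 t * vector_derivative (circlepath 0 1) (at t within {0..1})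
        = (2 * of_real pi * \<i>) * f (exp (2 * of_real pi * \<i> * of_real t))"
      by (simp only:) (simp del: exp_of_real)
  qed
  then have "((\<lambda>t. k * f (e t)) has_integral (k * f 0)) {0..1}"
    by (simp only: k_def e_def)
  then have "((\<lambda>t. inverse k * (k * f (e t))) has_integral (inverse k * (k * f 0))) {0..1}"
    by (rule has_integral_mult_right)
  moreover have "inverse k * (k * z) = z" for z
    using \<open>k \<noteq> 0\<close> by simp
  ultimately have hi: "((\<lambda>t. f (e t)) has_integral f 0) {0..1}"
    by (simp only:)
  have "continuous_on UNIV f" using fh by (rule holomorphic_on_imp_continuous_on)
  then have "continuous_on {0..1} (\<lambda>t. f (e t))"
  proof (rule continuous_on_compose2)
    show "continuous_on {0..1} e" unfolding e_def by (intro continuous_intros)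
  qed simp
  then have si: "set_integrable lborel {0..1} (\<lambda>t. f (e t))"
    by (rule borel_integrable_atLeastAtMost')
  have "(LINT t:{0..1}|lborel. f (e t)) = f 0"
    using set_borel_integral_eq_integral(2)[OF si] integral_unique[OF hi] by (rule trans)
  then show ?thesis
    by (simp only: set_lebesgue_integral_def e_def f_def vector_smult_lzero)
qed

section \<open>Hermitian forms and the reproducing formula\<close>

text \<open>Compactness of the unit sphere gives a positive minimum, and homogeneity spreads it.
  Serves both the Levi form and the quadratic part of the kernel exponent in a single
  variable.\<close>

lemma quadratic_lower_bound:
  fixes f :: "'a::euclidean_space \<Rightarrow> real"
  assumes cont: "continuous_on UNIV f" and hom: "\<And>r x. f (r *\<^sub>R x) = r\<^sup>2 * f x"
    and pos: "\<And>x. x \<noteq> 0 \<Longrightarrow> 0 < f x"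
  shows "\<exists>c>0. \<forall>x. c * (norm x)\<^sup>2 \<le> f x"
proof -
  have "compact (sphere (0::'a) 1)" "sphere (0::'a) 1 \<noteq> {}" by auto
  moreover have "continuous_on (sphere 0 1) f" using cont by (rule continuous_on_subset) simp
  ultimately obtain x0 where x0: "x0 \<in> sphere 0 1" "\<And>y. y \<in> sphere 0 1 \<Longrightarrow> f x0 \<le> f y"
    by (metis continuous_attains_inf)
  have "f x0 * (norm x)\<^sup>2 \<le> f x" for x
  proof (cases "x = 0")
    case True
    then show ?thesis using hom[of 0 x] by simp
  next
    case False
    then have "f x0 \<le> f ((1 / norm x) *\<^sub>R x)" by (intro x0) simp
    then show ?thesis using False by (simp add: hom power_divide field_simps)
  qed
  moreover have "f x0 > 0" by (rule pos) (use x0 in auto)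
  ultimately show ?thesis by blast
qed

text \<open>Later \<open>H\<close> is the Levi form, linear in the first slot and antilinear in the
  second. The Fock weight is \<open>exp (- N x)\<close> with no factor 2, because \<open>N\<close>
  is compared with twice the weight function.\<close>

locale hermitian_form =
  fixes H :: "complex^'n \<Rightarrow> complex^'n \<Rightarrow> complex"
  assumes bilH: "bounded_bilinear H"
    and H_smult: "H (c *s x) y = c * H x y"
    and H_cnj: "H y x = cnj (H x y)"
    and H_pos: "x \<noteq> 0 \<Longrightarrow> 0 < Re (H x x)"
begin

sublocale H: bounded_bilinear H by (rule bilH)

definition N :: "complex^'n \<Rightarrow> real" where "N x = Re (H x x)"

lemma H_smult_right: "H x (c *s y) = cnj c * H x y"
  by (subst H_cnj) (simp add: H_smult H_cnj[symmetric])

lemma H_self: "H x x = of_real (N x)"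
  using H_cnj[of x x] by (simp add: N_def complex_eq_iff)

lemma Re_H_commute: "Re (H y x) = Re (H x y)"
  by (subst H_cnj) simp

lemma N_nonneg: "0 \<le> N x"
  using H_pos[of x] by (cases "x = 0") (auto simp: N_def H.zero_left)

lemma N_pos: "x \<noteq> 0 \<Longrightarrow> 0 < N x"
  using H_pos by (simp add: N_def)

lemma N_smult: "N (c *s x) = (cmod c)\<^sup>2 * N x"
proof -
  have "H (c *s x) (c *s x) = of_real ((cmod c)\<^sup>2) * H x x"
    using complex_norm_square[of c] by (simp add: H_smult H_smult_right)
  then show ?thesis by (simp add: N_def)
qed

lemma N_scaleR: "N (r *\<^sub>R x) = r\<^sup>2 * N x"
  by (simp add: N_def H.scaleR_left H.scaleR_right power2_eq_square)

lemma N_add: "N (x + y) = N x + N y + 2 * Re (H x y)"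
  by (simp add: N_def H.add_left H.add_right Re_H_commute[of x y])

lemma N_diff: "N (x - y) = N x + N y - 2 * Re (H x y)"
  by (simp add: N_def H.diff_left H.diff_right Re_H_commute[of x y])

lemma continuous_on_H [continuous_intros]:
  "continuous_on S f \<Longrightarrow> continuous_on S g \<Longrightarrow> continuous_on S (\<lambda>x. H (f x) (g x))"
  by (rule H.continuous_on)

lemma continuous_on_N [continuous_intros]:
  "continuous_on S f \<Longrightarrow> continuous_on S (\<lambda>x. N (f x))"
  unfolding N_def by (intro continuous_intros)

lemma N_lower_bound: "\<exists>c>0. \<forall>x. c * (norm x)\<^sup>2 \<le> N x"
  by (rule quadratic_lower_bound) (intro continuous_intros, rule N_scaleR, rule N_pos)

section \<open>Gaussian integrability, mean value property and reproducing kernel\<close>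

lemma integrable_exp_neg_N:
  assumes "a > 0"
  shows "integrable lborel (\<lambda>x. exp (b * norm x - a * N x))"
proof -
  obtain c where c: "c > 0" "\<And>x. c * (norm x)\<^sup>2 \<le> N x" using N_lower_bound by blast
  show ?thesis
  proof (rule Bochner_Integration.integrable_bound)
    show "integrable lborel (\<lambda>x::complex^'n. exp (b * norm x - (a * c) * (norm x)\<^sup>2))"
      by (rule integrable_gaussian_linear) (use assms c in auto)
    show "(\<lambda>x. exp (b * norm x - a * N x)) \<in> borel_measurable lborel"
      by (simp, intro borel_measurable_continuous_onI continuous_intros)
    have "a * (c * (norm x)\<^sup>2) \<le> a * N x" for x
      using c(2)[of x] assms by (intro mult_left_mono) auto
    then show "AE x in lborel. norm (exp (b * norm x - a * N x)) \<le> norm (exp (b * norm x - (a * c) * (norm x)\<^sup>2))"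
      by (simp add: mult.assoc)
  qed
qed

text \<open>Normalisation of the reproducing kernel \<open>exp (H y w)\<close>; it equals pi^n
  divided by the determinant of the matrix of \<open>H\<close>.\<close>

definition Z :: real where "Z = (\<integral>x. exp (- N x) \<partial>lborel)"

lemma Z_pos: "0 < Z"
proof -
  have int: "integrable lborel (\<lambda>x. exp (- N x))"
    using integrable_exp_neg_N[of 1 0] by simp
  have "Z \<noteq> 0"
  proof
    assume "Z = 0"
    then have "AE x in (lborel :: (complex^'n) measure). exp (- N x) = 0"
      unfolding Z_def by (subst (asm) integral_nonneg_eq_0_iff_AE[OF int]) auto
    then have "AE x in (lborel :: (complex^'n) measure). False" by simp
    then show False
      using emeasure_lborel_UNIV[where 'a="complex^'n"] by (simp add: AE_iff_null null_sets_def)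
  qed
  moreover have "0 \<le> Z" unfolding Z_def by simp
  ultimately show ?thesis by simp
qed

text \<open>Multiplication by \<open>e t\<close> preserves Lebesgue measure and \<open>N\<close>, so
  the integral may be averaged over \<open>t\<close> in the unit interval; after exchanging the
  integrals, the inner one is the circle mean \<open>u 0\<close> for every \<open>w\<close>.\<close>

lemma holo_n_gaussian_mean:
  assumes u: "holo_n u" and int: "integrable lborel (\<lambda>w. u w * exp (- of_real (N w)))"
  shows "(\<integral>w. u w * exp (- of_real (N w)) \<partial>lborel) = u 0 * of_real Z"
proof -
  define e where "e t = exp (2 * of_real pi * \<i> * complex_of_real t)" for t
  define F where "F t w = indicator {0..1::real} t *\<^sub>R (u (e t *s w) * exp (- of_real (N w)))" for t w
  define I where "I = (\<integral>w. u w * exp (- of_real (N w)) \<partial>lborel)"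
  have e1: "cmod (e t) = 1" for t by (simp add: e_def)
  have contu: "continuous_on UNIV u" by (rule holo_n_continuous[OF u])
  have meas: "(\<lambda>w. u w * exp (- of_real (N w))) \<in> borel_measurable borel"
    by (intro borel_measurable_continuous_onI continuous_intros contu)
  have dist: "distr lborel borel (\<lambda>w::complex^'n. e t *s w) = lborel" for t
    by (rule distr_lborel_isometry)
       (auto simp: norm_vector_smult e1 bounded_linear.linear[OF bounded_linear_smult_right])
  have measT: "(\<lambda>w::complex^'n. e t *s w) \<in> borel_measurable borel" for t
    by (intro borel_measurable_continuous_onI linear_continuous_on bounded_linear_smult_right)
  have eqN: "N (e t *s w) = N w" for t w by (simp add: N_smult e1)
  have intt: "integrable lborel (\<lambda>w. u (e t *s w) * exp (- of_real (N w)))" for t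
  proof -
    have "integrable (distr lborel borel (\<lambda>w. e t *s w)) (\<lambda>w. u w * exp (- of_real (N w)))"
      using int by (simp add: dist)
    then show ?thesis using meas measT by (simp add: integrable_distr_eq eqN)
  qed
  have inI: "(\<integral>w. u (e t *s w) * exp (- of_real (N w)) \<partial>lborel) = I" for t
  proof -
    have "I = (\<integral>w. u w * exp (- of_real (N w)) \<partial>distr lborel borel (\<lambda>w. e t *s w))"
      by (simp add: dist I_def)
    also have "\<dots> = (\<integral>w. u (e t *s w) * exp (- of_real (N w)) \<partial>lborel)"
      using meas measT by (simp add: integral_distr eqN)
    finally show ?thesis by simp
  qed
  define J where "J = (\<integral>w. cmod (u w * exp (- of_real (N w))) \<partial>lborel)"
  have inJ: "(\<integral>w. cmod (u (e t *s w) * exp (- of_real (N w))) \<partial>lborel) = J" for t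
  proof -
    have "J = (\<integral>w. cmod (u w * exp (- of_real (N w))) \<partial>distr lborel borel (\<lambda>w. e t *s w))"
      by (simp add: dist J_def)
    also have "\<dots> = (\<integral>w. cmod (u (e t *s w) * exp (- of_real (N w))) \<partial>lborel)"
      using meas measT by (subst integral_distr) (auto simp: eqN)
    finally show ?thesis by simp
  qed
  have contG: "continuous_on UNIV (\<lambda>p::real \<times> (complex^'n). u (e (fst p) *s snd p) * exp (- of_real (N (snd p))))"
  proof -
    have "continuous_on UNIV (\<lambda>p::real \<times> (complex^'n). e (fst p) *s snd p)"
      unfolding e_def vector_scalar_mult_def
      by (intro continuous_intros continuous_on_vec_lambda)
    then have "continuous_on UNIV (\<lambda>p::real \<times> (complex^'n). u (e (fst p) *s snd p))"
      by (rule continuous_on_compose2[OF contu]) simp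
    then show ?thesis by (intro continuous_intros)
  qed
  have Fm: "(\<lambda>(t, w). F t w) \<in> borel_measurable (lborel \<Otimes>\<^sub>M lborel)"
  proof -
    have m1: "(\<lambda>p::real \<times> (complex^'n). u (e (fst p) *s snd p) * exp (- of_real (N (snd p)))) \<in> borel_measurable borel"
      by (rule borel_measurable_continuous_onI[OF contG])
    have "(\<lambda>p::real \<times> (complex^'n). indicator {0..1::real} (fst p) :: real) \<in> borel_measurable (borel \<Otimes>\<^sub>M borel)"
      by measurable
    then have m2: "(\<lambda>p::real \<times> (complex^'n). indicator {0..1::real} (fst p) :: real) \<in> borel_measurable borel"
      by (simp only: borel_prod)
    have "(\<lambda>p::real \<times> (complex^'n). indicator {0..1::real} (fst p) *\<^sub>R (u (e (fst p) *s snd p) * exp (- of_real (N (snd p)))))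
        \<in> borel_measurable borel"
      by (rule borel_measurable_scaleR[OF m2 m1])
    then show ?thesis by (simp add: F_def lborel_prod case_prod_unfold)
  qed
  \<comment> \<open>The absolute integral over \<open>w\<close> is the same number \<open>J\<close>
    for every \<open>t\<close>, so Fubini's hypothesis reduces to the finite length of the unit
    interval.\<close>
  have Fi: "integrable (lborel \<Otimes>\<^sub>M lborel) (\<lambda>(t, w). F t w)"
  proof (rule lborel_pair.Fubini_integrable[OF Fm])
    have "(\<integral>w. norm (case (t, w) of (t, w) \<Rightarrow> F t w) \<partial>lborel) = indicator {0..1} t * J" for t
      by (simp add: F_def inJ del: norm_mult)
    moreover have "integrable lborel (\<lambda>t::real. indicator {0..1} t * J)"
      by (intro integrable_mult_left integrable_real_indicator) auto
    ultimately show "integrable lborel (\<lambda>t. \<integral>w. norm (case (t, w) of (t, w) \<Rightarrow> F t w) \<partial>lborel)" by simp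
    show "AE t in lborel. integrable lborel (\<lambda>w. case (t, w) of (t, w) \<Rightarrow> F t w)"
      using intt by (auto simp: F_def)
  qed
  have "(\<integral>w. (\<integral>t. F t w \<partial>lborel) \<partial>lborel) = (\<integral>t. (\<integral>w. F t w \<partial>lborel) \<partial>lborel)"
    by (rule lborel_pair.Fubini_integral[OF Fi])
  moreover have "(\<integral>t. F t w \<partial>lborel) = u 0 * exp (- of_real (N w))" for w
  proof -
    have "F t w = (indicator {0..1} t *\<^sub>R u (e t *s w)) * exp (- of_real (N w))" for t
      by (simp add: F_def)
    then have "(\<integral>t. F t w \<partial>lborel) = (\<integral>t. indicator {0..1} t *\<^sub>R u (e t *s w) \<partial>lborel) * exp (- of_real (N w))"
      by (simp only: integral_mult_left_zero)
    also have "\<dots> = u 0 * exp (- of_real (N w))"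
      using holo_n_circle_mean[OF u, of w] by (simp add: e_def)
    finally show ?thesis .
  qed
  moreover have "(\<integral>w. F t w \<partial>lborel) = indicator {0..1} t *\<^sub>R I" for t
    by (simp add: F_def inI)
  moreover have "(\<integral>t. indicator {0..1::real} t *\<^sub>R I \<partial>lborel) = I"
    by simp
  moreover have "(\<integral>w. u 0 * exp (- complex_of_real (N w)) \<partial>lborel) = u 0 * of_real Z"
  proof -
    have "(\<lambda>w. exp (- complex_of_real (N w))) = (\<lambda>w. complex_of_real (exp (- N w)))"
      by (simp add: exp_of_real[symmetric])
    then have "(\<integral>w. u 0 * exp (- complex_of_real (N w)) \<partial>lborel) = (\<integral>w. u 0 * complex_of_real (exp (- N w)) \<partial>lborel)"
      by (simp only: fun_eq_iff)
    then show ?thesis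
      by (simp only: integral_mult_right_zero integral_complex_of_real Z_def)
  qed
  ultimately show ?thesis by (simp add: I_def)
qed

lemma holo_n_H_left: "holo_n (\<lambda>x. H x y)"
  by (rule holo_n_linear[OF H.bounded_linear_left]) (simp add: H_smult)

text \<open>Translating by \<open>y\<close> turns the integrand into
  \<open>v (w + y) * exp (H w (- y))\<close> times the Gaussian; the first two factors form an
  entire function of \<open>w\<close> with value \<open>v y\<close> at 0, to which the Gaussian mean
  value property applies. The weighted L1 hypothesis is the one that \<open>weyl_dom\<close> becomes
  after the gauge transformation.\<close>

lemma reproducing_formula:
  assumes v: "holo_n v" and int: "integrable lborel (\<lambda>w. cmod (v w) * exp (- N w / 2))"
  shows "integrable lborel (\<lambda>w. exp (H y w) * v w * exp (- of_real (N w)))"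
    and "(\<integral>w. exp (H y w) * v w * exp (- of_real (N w)) \<partial>lborel) = v y * of_real Z"
proof -
  have vm: "v \<in> borel_measurable borel" by (rule holo_n_measurable[OF v])
  define f where "f w = exp (H y w) * v w * exp (- of_real (N w))" for w
  have fm: "f \<in> borel_measurable borel"
    unfolding f_def by (intro borel_measurable_continuous_onI continuous_intros holo_n_continuous v)
  show int_f: "integrable lborel f"
  proof (rule Bochner_Integration.integrable_bound)
    show "integrable lborel (\<lambda>w. exp (N y / 2) * (cmod (v w) * exp (- N w / 2)))"
      by (intro integrable_mult_right int)
    have "cmod (f w) \<le> exp (N y / 2) * (cmod (v w) * exp (- N w / 2))" for w
    proof -
      \<comment> \<open>This is \<open>0 \<le> N (y - w)\<close> expanded; it leaves exactly the
        weight \<open>exp (- N w / 2)\<close> of the hypothesis.\<close>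
      have "Re (H y w) - N w \<le> N y / 2 - N w / 2"
        using N_diff[of y w] N_nonneg[of "y - w"] by simp
      then have "exp (Re (H y w) - N w) \<le> exp (N y / 2 - N w / 2)" by simp
      then have "exp (Re (H y w) - N w) * cmod (v w) \<le> exp (N y / 2 - N w / 2) * cmod (v w)"
        by (rule mult_right_mono) simp
      moreover have "exp (Re (H y w) - N w) * cmod (v w) = cmod (f w)"
        by (simp add: f_def norm_mult mult_exp_exp[symmetric] exp_diff exp_minus divide_inverse norm_inverse del: exp_of_real)
      moreover have "exp (N y / 2 - N w / 2) * cmod (v w) = exp (N y / 2) * (cmod (v w) * exp (- N w / 2))"
        by (simp add: mult_exp_exp mult.assoc[symmetric] mult.commute[of "cmod (v w)"])
      ultimately show ?thesis by simp
    qed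
    then show "AE w in lborel. norm (f w) \<le> norm (exp (N y / 2) * (cmod (v w) * exp (- N w / 2)))"
      by simp
  qed (use fm in simp)
  define u where "u w = v (w + y) * exp (H w (- y))" for w
  have u: "holo_n u"
    unfolding u_def by (intro holo_n_mult holo_n_translate holo_n_exp holo_n_H_left v)
  have eq: "f (y + 1 *\<^sub>R w) = u w * exp (- of_real (N w))" for w
  proof -
    have "H y (y + w) + (- of_real (N (y + w))) = H w (- y) + (- of_real (N w))"
    proof -
      have "complex_of_real (N (y + w)) = H y y + H w y + (H y w + of_real (N w))"
        using H_self[of "y + w"] H_self[of w] by (simp add: H.add_left H.add_right)
      then show ?thesis by (simp add: H.add_right H.minus_right)
    qed
    then have "exp (H y (y + w)) * exp (- of_real (N (y + w))) = exp (H w (- y)) * exp (- of_real (N w))"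
      by (simp only: exp_add[symmetric])
    then show ?thesis unfolding f_def u_def scaleR_one by (simp only: add.commute[of w y] mult_ac)
  qed
  have "integrable lborel (\<lambda>w. u w * exp (- of_real (N w)))"
    using integrable_lborel_affine[OF fm _ int_f, of 1 y] unfolding eq by simp
  from holo_n_gaussian_mean[OF u this]
  have "(\<integral>w. f (y + 1 *\<^sub>R w) \<partial>lborel) = v y * of_real Z"
    unfolding eq by (simp add: u_def H.zero_left)
  then show "(\<integral>w. f w \<partial>lborel) = v y * of_real Z"
    using integral_lborel_affine[OF fm, of 1 y] by simp
qed

end

section \<open>Complex Gaussian integrals\<close>

text \<open>\<open>A\<close> is a complex symmetric matrix with negative definite real part, acting
  on a real space; that space will be C^n with its 2n real coordinates.\<close>

locale complex_gaussian =
  fixes A :: "'a::euclidean_space \<Rightarrow> 'a \<Rightarrow> complex" and c :: real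
  assumes bilA: "bounded_bilinear A"
    and A_sym: "A x y = A y x"
    and c_pos: "0 < c"
    and A_neg: "Re (A x x) \<le> - (c * (norm x)\<^sup>2)"
begin

sublocale A: bounded_bilinear A by (rule bilA)

text \<open>The only term quadratic in \<open>m\<close> does not contain \<open>z\<close>, so for
  bounded \<open>z\<close> the integrand and its derivative are dominated by a multiple of a single
  function exp (const |m| - c |m|^2).\<close>

lemma gaussian_complex_translate_entire:
  "(\<lambda>z. \<integral>m. exp (A m m + 2 * z * A m t + z\<^sup>2 * A t t) \<partial>lborel) holomorphic_on UNIV"
proof -
  define g where "g z m = A m m + 2 * z * A m t + z\<^sup>2 * A t t" for z m
  obtain K where K: "0 \<le> K" "\<And>m. cmod (A m t) \<le> K * norm m"
    using bounded_linear.nonneg_bounded[OF A.bounded_linear_left[of t]] by (auto simp: mult.commute)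
  define L where "L = cmod (A t t)"
  have contg: "continuous_on UNIV (\<lambda>m. g z m)" for z
    unfolding g_def by (intro continuous_intros A.continuous_on)
  have "\<exists>d. ((\<lambda>z. \<integral>m. exp (g z m) \<partial>lborel) has_field_derivative d) (at z0)" for z0
  proof -
    define R where "R = cmod z0 + 1"
    \<comment> \<open>\<open>Re_g\<close> accounts for \<open>2 * R * K\<close> and
      \<open>R\<^sup>2 * L\<close>; the remaining \<open>2 * K\<close> and \<open>2 * R * L\<close>
      come from bounding the factor that differentiation brings down by the exponential of its own
      bound.\<close>
    define B where "B m = exp (2*R*L + R\<^sup>2*L) * exp ((2*K + 2*R*K) * norm m - c * (norm m)\<^sup>2)" for m :: 'a
    have R0: "0 \<le> R" by (simp add: R_def)
    have L0: "0 \<le> L" by (simp add: L_def)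
    have zR: "cmod z \<le> R" if "z \<in> ball z0 1" for z
      using that norm_triangle_ineq2[of z z0] by (simp add: R_def dist_norm norm_minus_commute)
    have Re_g: "Re (g z m) \<le> - (c * (norm m)\<^sup>2) + 2 * R * K * norm m + R\<^sup>2 * L" if z: "z \<in> ball z0 1" for z m
    proof -
      have "cmod (z * A m t) \<le> R * (K * norm m)"
        unfolding norm_mult by (intro mult_mono zR z K R0) auto
      then have "Re (z * A m t) \<le> R * (K * norm m)" using complex_Re_le_cmod order_trans by blast
      moreover have "cmod (z\<^sup>2 * A t t) \<le> R\<^sup>2 * L"
        unfolding norm_mult norm_power L_def by (intro mult_right_mono power_mono zR z) auto
      then have "Re (z\<^sup>2 * A t t) \<le> R\<^sup>2 * L" using complex_Re_le_cmod order_trans by blast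
      ultimately show ?thesis using A_neg[of m] by (simp add: g_def mult.assoc)
    qed
    have dg: "cmod (2 * A m t + 2 * z * A t t) \<le> 2 * K * norm m + 2 * R * L" if z: "z \<in> ball z0 1" for z m
    proof -
      have "cmod (2 * A m t) \<le> 2 * (K * norm m)" using K(2)[of m] by (simp add: norm_mult)
      moreover have "cmod (2 * z * A t t) \<le> 2 * (R * L)"
        using mult_right_mono[OF zR[OF z] L0] by (simp add: norm_mult L_def mult.assoc)
      ultimately show ?thesis using norm_triangle_ineq[of "2 * A m t" "2 * z * A t t"] by (simp add: mult.assoc)
    qed
    have bnd: "cmod ((2 * A m t + 2 * z * A t t) * exp (g z m)) \<le> B m" if z: "z \<in> ball z0 1" for z m
    proof -
      have "2 * K * norm m + 2 * R * L \<le> exp (2 * K * norm m + 2 * R * L)"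
        using exp_ge_add_one_self[of "2 * K * norm m + 2 * R * L"] by linarith
      then have 1: "cmod (2 * A m t + 2 * z * A t t) \<le> exp (2 * K * norm m + 2 * R * L)"
        using dg[OF z] order_trans by blast
      have 2: "cmod (exp (g z m)) \<le> exp (- (c * (norm m)\<^sup>2) + 2 * R * K * norm m + R\<^sup>2 * L)"
        using Re_g[OF z] by simp
      have "cmod ((2 * A m t + 2 * z * A t t) * exp (g z m))
          \<le> exp (2 * K * norm m + 2 * R * L) * exp (- (c * (norm m)\<^sup>2) + 2 * R * K * norm m + R\<^sup>2 * L)"
        unfolding norm_mult by (intro mult_mono 1 2) auto
      also have "\<dots> = B m" by (simp add: B_def mult_exp_exp algebra_simps)
      finally show ?thesis .
    qed
    have intB: "integrable lborel B"
      unfolding B_def by (intro integrable_mult_right integrable_gaussian_linear c_pos)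
    have "((\<lambda>z. \<integral>m. exp (g z m) \<partial>lborel) has_derivative
        (\<lambda>k. \<integral>m. (2 * A m t + 2 * z0 * A t t) * exp (g z0 m) * k \<partial>lborel)) (at z0)"
    proof (rule has_derivative_integral_dominated[where r=1 and B=B and
          D="\<lambda>z m k. (2 * A m t + 2 * z * A t t) * exp (g z m) * k"])
      fix z assume z: "z \<in> ball z0 1"
      show "integrable lborel (\<lambda>m. exp (g z m))"
      proof (rule Bochner_Integration.integrable_bound)
        show "integrable lborel (\<lambda>m. exp (R\<^sup>2*L) * exp ((2*R*K) * norm m - c * (norm m)\<^sup>2))"
          by (intro integrable_mult_right integrable_gaussian_linear c_pos)
        show "(\<lambda>m. exp (g z m)) \<in> borel_measurable lborel"
          by (simp, intro borel_measurable_continuous_onI continuous_intros contg)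
        have "cmod (exp (g z m)) \<le> exp (R\<^sup>2*L) * exp ((2*R*K) * norm m - c * (norm m)\<^sup>2)" for m
          using Re_g[OF z, of m] by (simp add: mult_exp_exp algebra_simps)
        then show "AE m in lborel. norm (exp (g z m)) \<le> norm (exp (R\<^sup>2*L) * exp ((2*R*K) * norm m - c * (norm m)\<^sup>2))"
          by simp
      qed
      fix m
      show "((\<lambda>z. exp (g z m)) has_derivative (\<lambda>k. (2 * A m t + 2 * z * A t t) * exp (g z m) * k)) (at z)"
      proof -
        have "((\<lambda>z. exp (g z m)) has_field_derivative (2 * A m t + 2 * z * A t t) * exp (g z m)) (at z)"
          unfolding g_def by (auto intro!: derivative_eq_intros)
        then show ?thesis by (simp add: has_field_derivative_def)
      qed
      show "norm ((2 * A m t + 2 * z * A t t) * exp (g z m) * k) \<le> B m * norm k" for k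
        unfolding norm_mult[of _ k] by (intro mult_right_mono bnd z) auto
    next
      show "(\<lambda>m. (2 * A m t + 2 * z0 * A t t) * exp (g z0 m) * h) \<in> borel_measurable lborel" for h
        by (simp, intro borel_measurable_continuous_onI continuous_intros contg A.continuous_on)
    qed (use intB in auto)
    moreover have "(\<lambda>k. \<integral>m. (2 * A m t + 2 * z0 * A t t) * exp (g z0 m) * k \<partial>lborel)
        = (*) (\<integral>m. (2 * A m t + 2 * z0 * A t t) * exp (g z0 m) \<partial>lborel)"
      by (rule ext) (simp only: integral_mult_left_zero)
    ultimately have "((\<lambda>z. \<integral>m. exp (g z m) \<partial>lborel) has_field_derivative
        (\<integral>m. (2 * A m t + 2 * z0 * A t t) * exp (g z0 m) \<partial>lborel)) (at z0)"
      by (simp only: has_field_derivative_def)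
    then show ?thesis by blast
  qed
  then show ?thesis
    unfolding g_def holomorphic_on_def field_differentiable_def by blast
qed

text \<open>With \<open>z\<close> in place of \<open>- \<i>\<close>, the left-hand side of the next lemma is entire in \<open>z\<close> and, by
  translation invariance, constant for real \<open>z\<close>.\<close>
lemma gaussian_imaginary_translate:
  "(\<integral>m. exp (A m m - 2 * \<i> * A m t - A t t) \<partial>lborel) = (\<integral>m. exp (A m m) \<partial>lborel)"
proof -
  define h where "h z = (\<integral>m. exp (A m m + 2 * z * A m t + z\<^sup>2 * A t t) \<partial>lborel) - (\<integral>m. exp (A m m) \<partial>lborel)" for z
  have hol: "h holomorphic_on UNIV"
    unfolding h_def by (intro holomorphic_intros gaussian_complex_translate_entire)
  have lim: "(0::complex) islimpt \<real>"
    unfolding islimpt_approachable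
  proof (intro allI impI)
    fix e :: real assume "e > 0"
    then show "\<exists>x'\<in>\<real>. x' \<noteq> (0::complex) \<and> dist x' 0 < e"
      by (intro bexI[of _ "of_real (e/2)"]) auto
  qed
  have zero: "h z = 0" if zr: "z \<in> \<real>" for z
  proof -
    obtain r where r: "z = of_real r" using zr by (auto simp: Reals_def)
    have meas: "(\<lambda>m. exp (A m m)) \<in> borel_measurable borel"
      by (intro borel_measurable_continuous_onI continuous_intros A.continuous_on)
    have eq: "A (r *\<^sub>R t + m) (r *\<^sub>R t + m) = A m m + 2 * z * A m t + z\<^sup>2 * A t t" for m
      by (simp add: A.add_left A.add_right A.scaleR_left A.scaleR_right A_sym[of t m] r
          scaleR_conv_of_real power2_eq_square algebra_simps)
    from integral_lborel_affine[OF meas one_neq_zero, of "r *\<^sub>R t"] show ?thesis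
      unfolding h_def right_minus_eq abs_one power_one scaleR_one eq by (rule sym)
  qed
  have "h (- \<i>) = 0"
    by (rule analytic_continuation[OF hol open_UNIV connected_UNIV subset_UNIV UNIV_I lim zero UNIV_I])
  then show ?thesis by (simp add: h_def)
qed

text \<open>Formally the substitution of m + s + i t for m. The real shift is translation
  invariance, the imaginary one is \<open>gaussian_imaginary_translate\<close>; the critical value
  of a quadratic polynomial without constant term is half its linear part there.\<close>

lemma gaussian_complete_square:
  assumes crit: "\<And>h. 2 * A s h + 2 * \<i> * A t h + b h = 0" and b: "bounded_linear b"
  shows "(\<integral>m. exp (A m m + b m) \<partial>lborel) = exp ((b s + \<i> * b t) / 2) * (\<integral>m. exp (A m m) \<partial>lborel)"
proof -
  have bh: "b h = - 2 * A s h - 2 * \<i> * A t h" for h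
    using crit[of h] by (simp add: algebra_simps eq_neg_iff_add_eq_0)
  have meas: "(\<lambda>m. exp (A m m + b m)) \<in> borel_measurable borel"
    by (intro borel_measurable_continuous_onI continuous_intros A.continuous_on linear_continuous_on b)
  have "A (s + m) (s + m) + b (s + m) = (b s + \<i> * b t) / 2 + (A m m - 2 * \<i> * A m t - A t t)" for m
    unfolding bh by (simp add: A.add_left A.add_right A_sym[of m s] A_sym[of m t] A_sym[of t s] field_simps)
  then have "exp (A (s + m) (s + m) + b (s + m)) = exp ((b s + \<i> * b t) / 2) * exp (A m m - 2 * \<i> * A m t - A t t)" for m
    by (simp only: exp_add[symmetric])
  then have "(\<integral>m. exp (A (s + m) (s + m) + b (s + m)) \<partial>lborel)
      = exp ((b s + \<i> * b t) / 2) * (\<integral>m. exp (A m m) \<partial>lborel)"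
    by (simp only: integral_mult_right_zero gaussian_imaginary_translate)
  then show ?thesis
    using integral_lborel_affine[OF meas, of 1 s] by simp
qed

text \<open>Testing with \<open>s\<close> and with \<open>t\<close> and using symmetry gives
  \<open>A s s + A t t = 0\<close>, which the negative definite real part permits only at the
  origin.\<close>

lemma critical_point_unique:
  assumes "\<And>h. A s h + \<i> * A t h = 0"
  shows "s = 0" "t = 0"
proof -
  have 1: "A s s = - \<i> * A t s" and 2: "A t t = \<i> * A s t"
    using assms[of s] assms[of t] by (simp_all add: complex_eq_iff)
  then have "A s s + A t t = 0" using A_sym[of s t] by simp
  then have "Re (A s s) + Re (A t t) = 0" by (metis plus_complex.sel(1) zero_complex.sel(1))
  then have "c * (norm s)\<^sup>2 + c * (norm t)\<^sup>2 \<le> 0" using A_neg[of s] A_neg[of t] by simp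
  moreover have "0 \<le> c * (norm s)\<^sup>2" "0 \<le> c * (norm t)\<^sup>2" using c_pos by auto
  ultimately have "c * (norm s)\<^sup>2 = 0" "c * (norm t)\<^sup>2 = 0" by linarith+
  then show "s = 0" "t = 0" using c_pos by auto
qed

lemma critical_point_exists:
  assumes b: "bounded_linear b"
  shows "\<exists>s t. \<forall>h. 2 * A s h + 2 * \<i> * A t h + b h = 0"
proof -
  define f where "f p h = 2 * A (fst p) h + 2 * \<i> * A (snd p) h" for p h
  \<comment> \<open>The functional is encoded by its real and imaginary parts on a basis. This makes
    a real linear endomorphism of pairs, injective by uniqueness of the critical point and hence
    surjective by dimension.\<close>
  define \<Lambda> where "\<Lambda> p = ((\<Sum>e\<in>Basis. Re (f p e) *\<^sub>R e), (\<Sum>e\<in>Basis. Im (f p e) *\<^sub>R e))" for p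
  have linf: "linear (f p)" for p
    unfolding f_def by (rule linearI) (simp_all add: A.add_right A.scaleR_right algebra_simps scaleR_conv_of_real)
  have lin: "linear \<Lambda>"
  proof (rule linearI)
    fix p q :: "'a \<times> 'a" and r :: real
    have "f (p + q) e = f p e + f q e" "f (r *\<^sub>R p) e = r *\<^sub>R f p e" for e
      by (simp_all add: f_def A.add_left A.scaleR_left algebra_simps)
    then show "\<Lambda> (p + q) = \<Lambda> p + \<Lambda> q" "\<Lambda> (r *\<^sub>R p) = r *\<^sub>R \<Lambda> p"
      by (simp_all add: \<Lambda>_def scaleR_add_left sum.distrib scaleR_sum_right)
  qed
  have comp: "fst (\<Lambda> p) \<bullet> e = Re (f p e)" "snd (\<Lambda> p) \<bullet> e = Im (f p e)" if "e \<in> Basis" for p e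
    using that by (simp_all add: \<Lambda>_def)
  have "inj \<Lambda>"
    unfolding linear_injective_0[OF lin]
  proof (intro allI impI)
    fix p assume p: "\<Lambda> p = 0"
    have "f p e = 0" if "e \<in> Basis" for e
      using comp[OF that, of p] p by (simp add: complex_eq_iff)
    then have "f p = (\<lambda>_. 0)"
      by (intro linear_eq_stdbasis linf) (auto intro: linearI)
    moreover have "f p h = 2 * (A (fst p) h + \<i> * A (snd p) h)" for h
      by (simp add: f_def algebra_simps)
    ultimately have "A (fst p) h + \<i> * A (snd p) h = 0" for h
      by (metis mult_eq_0_iff zero_neq_numeral)
    from critical_point_unique[OF this] show "p = 0" by (simp add: prod_eq_iff)
  qed
  then have "surj \<Lambda>" using lin by (simp add: linear_inj_imp_surj)
  then obtain p where "- ((\<Sum>e\<in>Basis. Re (b e) *\<^sub>R e), (\<Sum>e\<in>Basis. Im (b e) *\<^sub>R e)) = \<Lambda> p"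
    by (rule surjE)
  note p = this[symmetric]
  have "f p e = - b e" if "e \<in> Basis" for e
    using comp[OF that, of p] that by (simp add: p complex_eq_iff)
  then have "f p = (\<lambda>h. - b h)"
    by (intro linear_eq_stdbasis linf) (auto intro: bounded_linear.linear bounded_linear_minus b)
  then have "2 * A (fst p) h + 2 * \<i> * A (snd p) h + b h = 0" for h
    by (simp add: f_def fun_eq_iff)
  then show ?thesis by blast
qed

end

section \<open>Schur test and the exponent of the kernel\<close>

text \<open>For \<open>x0\<close> with \<open>f x0\<close> within 1 of the supremum, the midpoint
  inequality yields a Gaussian bound centred at \<open>x0\<close>, and translation removes the
  centre. The resulting bound depends only on \<open>M\<close> and \<open>c\<close>, hence is
  uniform in a frozen variable, as Schur's test requires.\<close>

lemma nn_integral_exp_concave_quadratic: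
  fixes f :: "'a::euclidean_space \<Rightarrow> real"
  assumes le: "\<And>x. f x \<le> M"
    and mid: "\<And>x y. f x + f y \<le> 2 * f ((1/2) *\<^sub>R (x + y)) - c * (norm (x - y))\<^sup>2"
  shows "(\<integral>\<^sup>+x. ennreal (exp (f x)) \<partial>lborel) \<le> (\<integral>\<^sup>+x. ennreal (exp (M + 1 - c * (norm (x::'a))\<^sup>2)) \<partial>lborel)"
proof -
  define S where "S = (SUP x. f x)"
  have bdd: "bdd_above (range f)" using le by (auto simp: bdd_above_def)
  have fS: "f x \<le> S" for x unfolding S_def by (rule cSUP_upper[OF _ bdd]) simp
  have SM: "S \<le> M" unfolding S_def by (rule cSUP_least) (use le in auto)
  have "\<exists>x0\<in>UNIV. S - 1 < f x0"
    using less_cSUP_iff[OF _ bdd, of "S - 1"] by (simp add: S_def)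
  then obtain x0 where x0: "S - 1 < f x0" by blast
  have "f x \<le> M + 1 - c * (norm (x - x0))\<^sup>2" for x
    using mid[of x x0] fS[of "(1/2) *\<^sub>R (x + x0)"] x0 SM by linarith
  then have "(\<integral>\<^sup>+x. ennreal (exp (f x)) \<partial>lborel) \<le> (\<integral>\<^sup>+x. ennreal (exp (M + 1 - c * (norm (x - x0))\<^sup>2)) \<partial>lborel)"
    by (intro nn_integral_mono ennreal_leI) simp
  also have "\<dots> = (\<integral>\<^sup>+x. ennreal (exp (M + 1 - c * (norm (x::'a))\<^sup>2)) \<partial>lborel)"
  proof -
    have "(\<lambda>x::'a. ennreal (exp (M + 1 - c * (norm (x - x0))\<^sup>2))) \<in> borel_measurable borel" by measurable
    from nn_integral_lborel_affine[OF this, of 1 x0] show ?thesis by simp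
  qed
  finally show ?thesis .
qed

text \<open>Cauchy-Schwarz with \<open>exp k\<close> split into two square roots, then
  Tonelli.\<close>

lemma schur_test:
  fixes k :: "'a::euclidean_space \<Rightarrow> 'b::euclidean_space \<Rightarrow> real" and f :: "'b \<Rightarrow> ennreal"
  assumes k: "(\<lambda>p. k (fst p) (snd p)) \<in> borel_measurable borel" and f[measurable]: "f \<in> borel_measurable borel"
    and row: "\<And>x. (\<integral>\<^sup>+w. ennreal (exp (k x w)) \<partial>lborel) \<le> C"
    and col: "\<And>w. (\<integral>\<^sup>+x. ennreal (exp (k x w)) \<partial>lborel) \<le> C"
  shows "(\<integral>\<^sup>+x. (\<integral>\<^sup>+w. ennreal (exp (k x w)) * f w \<partial>lborel)\<^sup>2 \<partial>lborel) \<le> C * C * (\<integral>\<^sup>+w. (f w)\<^sup>2 \<partial>lborel)"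
proof -
  have k': "(\<lambda>p. k (fst p) (snd p)) \<in> borel_measurable (lborel \<Otimes>\<^sub>M lborel)"
    using k by (simp add: lborel_prod)
  then have [measurable]: "case_prod k \<in> borel_measurable (lborel \<Otimes>\<^sub>M lborel)"
    by (simp add: case_prod_unfold)
  have sq: "(ennreal (exp (k x w / 2)))\<^sup>2 = ennreal (exp (k x w))" for x w
    by (simp add: ennreal_power exp_double[symmetric])
  have "(\<integral>\<^sup>+w. ennreal (exp (k x w)) * f w \<partial>lborel)\<^sup>2 \<le> C * (\<integral>\<^sup>+w. ennreal (exp (k x w)) * (f w)\<^sup>2 \<partial>lborel)" for x
  proof -
    have "(\<integral>\<^sup>+w. ennreal (exp (k x w)) * f w \<partial>lborel)\<^sup>2
        = (\<integral>\<^sup>+w. ennreal (exp (k x w / 2)) * (ennreal (exp (k x w / 2)) * f w) \<partial>lborel)\<^sup>2"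
      by (simp only: mult.assoc[symmetric] power2_eq_square[symmetric] sq)
    also have "\<dots> \<le> (\<integral>\<^sup>+w. (ennreal (exp (k x w / 2)))\<^sup>2 \<partial>lborel) * (\<integral>\<^sup>+w. (ennreal (exp (k x w / 2)) * f w)\<^sup>2 \<partial>lborel)"
      by (rule Cauchy_Schwarz_nn_integral) measurable
    also have "\<dots> \<le> C * (\<integral>\<^sup>+w. ennreal (exp (k x w)) * (f w)\<^sup>2 \<partial>lborel)"
      unfolding power_mult_distrib sq by (intro mult_right_mono row) simp
    finally show ?thesis .
  qed
  then have "(\<integral>\<^sup>+x. (\<integral>\<^sup>+w. ennreal (exp (k x w)) * f w \<partial>lborel)\<^sup>2 \<partial>lborel)
      \<le> (\<integral>\<^sup>+x. C * (\<integral>\<^sup>+w. ennreal (exp (k x w)) * (f w)\<^sup>2 \<partial>lborel) \<partial>lborel)"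
    by (rule nn_integral_mono)
  also have "\<dots> = C * (\<integral>\<^sup>+x. (\<integral>\<^sup>+w. ennreal (exp (k x w)) * (f w)\<^sup>2 \<partial>lborel) \<partial>lborel)"
    by (rule nn_integral_cmult) measurable
  also have "(\<integral>\<^sup>+x. (\<integral>\<^sup>+w. ennreal (exp (k x w)) * (f w)\<^sup>2 \<partial>lborel) \<partial>lborel)
      = (\<integral>\<^sup>+w. (\<integral>\<^sup>+x. ennreal (exp (k x w)) * (f w)\<^sup>2 \<partial>lborel) \<partial>lborel)"
    by (rule lborel_pair.Fubini'[symmetric]) measurable
  also have "\<dots> = (\<integral>\<^sup>+w. (\<integral>\<^sup>+x. ennreal (exp (k x w)) \<partial>lborel) * (f w)\<^sup>2 \<partial>lborel)"
    by (intro nn_integral_cong nn_integral_multc) measurable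
  also have "C * \<dots> \<le> C * (\<integral>\<^sup>+w. C * (f w)\<^sup>2 \<partial>lborel)"
    by (intro mult_left_mono nn_integral_mono mult_right_mono col) auto
  also have "(\<integral>\<^sup>+w. C * (f w)\<^sup>2 \<partial>lborel) = C * (\<integral>\<^sup>+w. (f w)\<^sup>2 \<partial>lborel)"
    by (rule nn_integral_cmult) measurable
  finally show ?thesis by (simp add: mult.assoc)
qed

text \<open>\<open>G\<close> and \<open>l\<close> are the quadratic and linear parts of the
  logarithm of the symbol on the graph, in the parameter x. \<open>H s h - H h s\<close> is i times
  the symplectic form pulled back to the graph, so the two clauses of \<open>nondeg\<close> encode
  the exclusion of the eigenvalues 2 and -2.\<close>

locale gaussian_symbol = hermitian_form H
  for H :: "complex^'n \<Rightarrow> complex^'n \<Rightarrow> complex" +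
  fixes G :: "complex^'n \<Rightarrow> complex^'n \<Rightarrow> complex" and l :: "complex^'n \<Rightarrow> complex" and M :: real
  assumes bilG: "bounded_bilinear G"
    and G_sym: "G x y = G y x"
    and lin_l: "bounded_linear l"
    and bnd: "Re (G x x + l x) \<le> M"
    and nondeg: "(\<And>h. G s h = H s h - H h s) \<Longrightarrow> s = 0" "(\<And>h. G s h = H h s - H s h) \<Longrightarrow> s = 0"
begin

sublocale G: bounded_bilinear G by (rule bilG)
sublocale l: bounded_linear l by (rule lin_l)

text \<open>Adding the bounds at opposite points removes \<open>l\<close>; a quadratic form bounded
  above on a line is nonpositive there.\<close>

lemma Re_G_nonpos: "Re (G x x) \<le> 0"
proof (rule ccontr)
  assume "\<not> Re (G x x) \<le> 0"
  then have g: "Re (G x x) > 0" by simp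
  define t where "t = sqrt ((\<bar>M\<bar> + 1) / Re (G x x))"
  have t2: "t\<^sup>2 = (\<bar>M\<bar> + 1) / Re (G x x)" unfolding t_def using g by simp
  have "t\<^sup>2 * Re (G x x) + t * Re (l x) \<le> M" "t\<^sup>2 * Re (G x x) - t * Re (l x) \<le> M"
    using bnd[of "t *\<^sub>R x"] bnd[of "- t *\<^sub>R x"]
    by (simp_all add: G.scaleR_left G.scaleR_right l.scaleR G.minus_left G.minus_right l.neg power2_eq_square mult.assoc)
  then have "t\<^sup>2 * Re (G x x) \<le> M" by linarith
  then show False using g by (simp add: t2)
qed

text \<open>On the diagonal this is \<open>G m m - 2 * of_real (N m)\<close>, the quadratic part of
  the kernel exponent in the midpoint m = (x + y) / 2; the Levi form is symmetrised to give a
  symmetric real bilinear form.\<close>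

definition A :: "complex^'n \<Rightarrow> complex^'n \<Rightarrow> complex" where "A x y = G x y - (H x y + H y x)"

lemma complex_gaussian_A: "\<exists>c. complex_gaussian A c"
proof -
  obtain c where c: "c > 0" "\<And>x. c * (norm x)\<^sup>2 \<le> N x" using N_lower_bound by blast
  have "complex_gaussian A c"
  proof (rule complex_gaussian.intro)
    have "bilinear A"
      unfolding bilinear_def A_def
      by (intro conjI allI linearI)
         (simp_all add: G.add_left G.add_right H.add_left H.add_right G.scaleR_left G.scaleR_right
           H.scaleR_left H.scaleR_right algebra_simps)
    then show "bounded_bilinear A" by (simp add: bilinear_conv_bounded_bilinear)
    show "A x y = A y x" for x y by (simp add: A_def G_sym[of x y])
    show "Re (A x x) \<le> - (c * (norm x)\<^sup>2)" for x
      using Re_G_nonpos[of x] c(2)[of x] N_nonneg[of x] by (simp add: A_def N_def)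
  qed (use c in auto)
  then show ?thesis by blast
qed

section \<open>The complex critical point and the exponent of the kernel\<close>

lemma crit_exists: "bounded_linear b \<Longrightarrow> \<exists>s t. \<forall>h. 2 * A s h + 2 * \<i> * A t h + b h = 0"
  using complex_gaussian_A complex_gaussian.critical_point_exists by metis

lemma crit_unique: "(\<And>h. A s h + \<i> * A t h = 0) \<Longrightarrow> s = 0 \<and> t = 0"
  using complex_gaussian_A complex_gaussian.critical_point_unique by metis

lemma bilA: "bounded_bilinear A"
  using complex_gaussian_A complex_gaussian.bilA by metis

sublocale A: bounded_bilinear A by (rule bilA)

lemma A_sym: "A x y = A y x"
  by (simp add: A_def G_sym[of x y])

text \<open>The critical point is affine in p = (x, w): \<open>crit0\<close> is its linear part,
  driven by x and w, and \<open>crit1\<close> the constant part, driven by \<open>l\<close>. The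
  choice is canonical by uniqueness, which is why it turns out linear.\<close>

definition crit0 :: "(complex^'n) \<times> (complex^'n) \<Rightarrow> (complex^'n) \<times> (complex^'n)" where
  "crit0 p = (SOME q. \<forall>h. A (fst q) h + \<i> * A (snd q) h + H (fst p) h + H h (snd p) = 0)"

definition crit1 :: "(complex^'n) \<times> (complex^'n)" where
  "crit1 = (SOME q. \<forall>h. 2 * A (fst q) h + 2 * \<i> * A (snd q) h + l h = 0)"

lemma crit0: "A (fst (crit0 p)) h + \<i> * A (snd (crit0 p)) h + H (fst p) h + H h (snd p) = 0"
proof -
  have "bounded_linear (\<lambda>h. 2 * H (fst p) h + 2 * H h (snd p))"
    by (intro bounded_linear_add bounded_linear_const_mult H.bounded_linear_left H.bounded_linear_right)
  from crit_exists[OF this] obtain s t where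
    st: "\<And>h. 2 * A s h + 2 * \<i> * A t h + (2 * H (fst p) h + 2 * H h (snd p)) = 0" by blast
  have "A s h + \<i> * A t h + H (fst p) h + H h (snd p) = 0" for h
  proof -
    have "2 * (A s h + \<i> * A t h + H (fst p) h + H h (snd p)) = 0"
      using st[of h] by (simp add: algebra_simps)
    then show ?thesis by (metis mult_eq_0_iff zero_neq_numeral)
  qed
  then have "\<exists>q. \<forall>h. A (fst q) h + \<i> * A (snd q) h + H (fst p) h + H h (snd p) = 0"
    by (intro exI[of _ "(s, t)"]) simp
  from someI_ex[OF this] show ?thesis unfolding crit0_def by blast
qed

lemma crit1: "2 * A (fst crit1) h + 2 * \<i> * A (snd crit1) h + l h = 0"
proof -
  obtain s t where "\<And>h. 2 * A s h + 2 * \<i> * A t h + l h = 0"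
    using crit_exists[OF lin_l] by blast
  then have "\<exists>q. \<forall>h. 2 * A (fst q) h + 2 * \<i> * A (snd q) h + l h = 0"
    by (intro exI[of _ "(s, t)"]) simp
  from someI_ex[OF this] show ?thesis unfolding crit1_def by blast
qed

lemma crit0_eqI:
  assumes "\<And>h. A (fst q) h + \<i> * A (snd q) h + H (fst p) h + H h (snd p) = 0"
  shows "crit0 p = q"
proof -
  have "A (fst (crit0 p) - fst q) h + \<i> * A (snd (crit0 p) - snd q) h = 0" for h
  proof -
    have "A (fst (crit0 p) - fst q) h + \<i> * A (snd (crit0 p) - snd q) h
      = (A (fst (crit0 p)) h + \<i> * A (snd (crit0 p)) h + H (fst p) h + H h (snd p))
        - (A (fst q) h + \<i> * A (snd q) h + H (fst p) h + H h (snd p))"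
      by (simp add: A.diff_left algebra_simps)
    then show ?thesis by (simp only: crit0 assms diff_self)
  qed
  from crit_unique[OF this] show ?thesis by (simp add: prod_eq_iff)
qed

lemma linear_crit0: "linear crit0"
proof (rule linearI)
  fix p q :: "(complex^'n) \<times> (complex^'n)" and r :: real
  show "crit0 (p + q) = crit0 p + crit0 q"
  proof (rule crit0_eqI)
    fix h
    have "A (fst (crit0 p + crit0 q)) h + \<i> * A (snd (crit0 p + crit0 q)) h + H (fst (p + q)) h + H h (snd (p + q))
      = (A (fst (crit0 p)) h + \<i> * A (snd (crit0 p)) h + H (fst p) h + H h (snd p))
        + (A (fst (crit0 q)) h + \<i> * A (snd (crit0 q)) h + H (fst q) h + H h (snd q))"
      by (simp add: A.add_left H.add_left H.add_right algebra_simps)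
    then show "A (fst (crit0 p + crit0 q)) h + \<i> * A (snd (crit0 p + crit0 q)) h + H (fst (p + q)) h + H h (snd (p + q)) = 0"
      by (simp only: crit0 add_0)
  qed
  show "crit0 (r *\<^sub>R p) = r *\<^sub>R crit0 p"
  proof (rule crit0_eqI)
    fix h
    have "A (fst (r *\<^sub>R crit0 p)) h + \<i> * A (snd (r *\<^sub>R crit0 p)) h + H (fst (r *\<^sub>R p)) h + H h (snd (r *\<^sub>R p))
      = r *\<^sub>R (A (fst (crit0 p)) h + \<i> * A (snd (crit0 p)) h + H (fst p) h + H h (snd p))"
      by (simp add: A.scaleR_left H.scaleR_left H.scaleR_right scaleR_add_right)
    then show "A (fst (r *\<^sub>R crit0 p)) h + \<i> * A (snd (r *\<^sub>R crit0 p)) h + H (fst (r *\<^sub>R p)) h + H h (snd (r *\<^sub>R p)) = 0"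
      by (simp only: crit0 scaleR_zero_right)
  qed
qed

lemma continuous_on_crit0 [continuous_intros]: "continuous_on S f \<Longrightarrow> continuous_on S (\<lambda>x. crit0 (f x))"
  by (rule continuous_on_compose2[OF linear_continuous_on[OF linear_conv_bounded_linear[THEN iffD1, OF linear_crit0]]]) auto

definition S :: "(complex^'n) \<times> (complex^'n) \<Rightarrow> complex^'n" where "S p = fst (crit0 p) + fst crit1"
definition T :: "(complex^'n) \<times> (complex^'n) \<Rightarrow> complex^'n" where "T p = snd (crit0 p) + snd crit1"

text \<open>With p = (x, w), the linear part of the kernel exponent in the midpoint
  variable.\<close>

definition b :: "(complex^'n) \<times> (complex^'n) \<Rightarrow> complex^'n \<Rightarrow> complex" where
  "b p h = 2 * H (fst p) h + 2 * H h (snd p) + l h"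

lemma bounded_linear_b: "bounded_linear (b p)"
  unfolding b_def
  by (intro bounded_linear_add bounded_linear_const_mult H.bounded_linear_left H.bounded_linear_right lin_l)

lemma crit_eq: "2 * A (S p) h + 2 * \<i> * A (T p) h + b p h = 0"
proof -
  have "2 * A (S p) h + 2 * \<i> * A (T p) h + b p h
    = 2 * (A (fst (crit0 p)) h + \<i> * A (snd (crit0 p)) h + H (fst p) h + H h (snd p))
      + (2 * A (fst crit1) h + 2 * \<i> * A (snd crit1) h + l h)"
    by (simp add: S_def T_def b_def A.add_left algebra_simps)
  then show ?thesis by (simp only: crit0 crit1 mult_zero_right add_0)
qed

text \<open>The first term is the critical value obtained by completing the square, the second the
  part of the exponent free of the integration variable; the last two are the Fock weights at x and
  w.\<close>

definition k :: "(complex^'n) \<times> (complex^'n) \<Rightarrow> real" where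
  "k p = Re ((b p (S p) + \<i> * b p (T p)) / 2) - Re (H (fst p) (snd p)) - N (fst p) / 2 - N (snd p) / 2"

text \<open>The real part of the critical equation tested with \<open>s\<close> and the imaginary
  part tested with \<open>t\<close> are added: the mixed terms cancel by symmetry of
  \<open>A\<close>, and \<open>Im (b p t)\<close> can be eliminated. In this form every term has a
  sign or is controlled by the bound on the symbol.\<close>

lemma k_eq:
  "k p = - (4 * N (T p) + N (2 *\<^sub>R S p - fst p - snd p) - 2 * Re (G (S p) (S p) + l (S p)) - 2 * Re (G (T p) (T p))) / 2"
proof -
  define s t x w where "s = S p" and "t = T p" and "x = fst p" and "w = snd p"
  have "2 * A s s + 2 * \<i> * A t s + b p s = 0" "2 * A s t + 2 * \<i> * A t t + b p t = 0"
    using crit_eq[of p] by (simp_all add: s_def t_def)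
  then have "Re (2 * A s s + 2 * \<i> * A t s + b p s) = 0" "Im (2 * A s t + 2 * \<i> * A t t + b p t) = 0"
    by simp_all
  moreover have "Im (A s t) = Im (A t s)" by (simp add: A_sym[of s t])
  ultimately have 1: "2 * Re (A s s) + 2 * Re (A t t) + Re (b p s) + Im (b p t) = 0"
    by simp
  have 2: "Re (A s s) = Re (G s s) - 2 * N s" "Re (A t t) = Re (G t t) - 2 * N t"
    by (simp_all add: A_def N_def)
  have 3: "Re (b p s) = 2 * Re (H x s) + 2 * Re (H w s) + Re (l s)"
    by (simp add: b_def x_def w_def Re_H_commute[of s])
  have 4: "N (2 *\<^sub>R s - x - w) = 4 * N s + N x + N w - 4 * Re (H x s) - 4 * Re (H w s) + 2 * Re (H x w)"
  proof -
    have "N (2 *\<^sub>R s - x - w) = N (2 *\<^sub>R s - (x + w))" by (simp add: algebra_simps)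
    also have "\<dots> = 4 * N s + N (x + w) - 4 * Re (H s (x + w))"
      by (simp add: N_diff N_scaleR H.scaleR_left)
    also have "\<dots> = 4 * N s + (N x + N w + 2 * Re (H x w)) - 4 * (Re (H x s) + Re (H w s))"
      unfolding N_add[of x w] by (simp add: H.add_right Re_H_commute[of s])
    finally show ?thesis by simp
  qed
  have 5: "k p = (Re (b p s) - Im (b p t)) / 2 - Re (H x w) - N x / 2 - N w / 2"
    by (simp add: k_def s_def t_def x_def w_def)
  show ?thesis
    unfolding s_def[symmetric] t_def[symmetric] x_def[symmetric] w_def[symmetric] 4 5
    using 1 2 3 by simp
qed

section \<open>Upper bound and concavity of the exponent\<close>

lemma k_le: "k p \<le> M"
  unfolding k_eq using N_nonneg[of "T p"] N_nonneg[of "2 *\<^sub>R S p - fst p - snd p"] bnd[of "S p"] Re_G_nonpos[of "T p"]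
  by simp

lemma continuous_on_k: "continuous_on UNIV k"
  unfolding k_eq S_def T_def
  by (intro continuous_intros G.continuous_on l.continuous_on) auto

text \<open>\<open>- q\<close> is the homogeneous quadratic part of \<open>k\<close>: in
  \<open>k_eq\<close> the term \<open>l\<close> is dropped and the affine critical point is replaced
  by its linear part.\<close>

definition q :: "(complex^'n) \<times> (complex^'n) \<Rightarrow> real" where
  "q p = (4 * N (snd (crit0 p)) + N (2 *\<^sub>R fst (crit0 p) - fst p - snd p)
     - 2 * Re (G (fst (crit0 p)) (fst (crit0 p))) - 2 * Re (G (snd (crit0 p)) (snd (crit0 p)))) / 2"

text \<open>The parallelogram identity for each quadratic term of \<open>k_eq\<close>; affine terms
  do not contribute. It avoids expanding \<open>k\<close> into homogeneous parts.\<close>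

lemma k_midpoint: "k p + k p' = 2 * k ((1/2) *\<^sub>R (p + p')) - q (p - p') / 2"
proof -
  have parN: "N x + N y = 2 * N ((1/2) *\<^sub>R (x + y)) + N (x - y) / 2" for x y
    unfolding N_scaleR N_add N_diff by (simp add: power2_eq_square field_simps)
  have parG: "Re (G x x) + Re (G y y) = 2 * Re (G ((1/2) *\<^sub>R (x + y)) ((1/2) *\<^sub>R (x + y))) + Re (G (x - y) (x - y)) / 2" for x y
    by (simp add: G.scaleR_left G.scaleR_right G.add_left G.add_right G.diff_left G.diff_right G_sym[of y x] field_simps)
  have midS: "S ((1/2) *\<^sub>R (p + p')) = (1/2) *\<^sub>R (S p + S p')" and midT: "T ((1/2) *\<^sub>R (p + p')) = (1/2) *\<^sub>R (T p + T p')"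
    unfolding S_def T_def linear_scale[OF linear_crit0] linear_add[OF linear_crit0] fst_scaleR snd_scaleR fst_add snd_add
    by (simp_all add: scaleR_add_right scaleR_add_left[symmetric])
  have dS: "fst (crit0 (p - p')) = S p - S p'" and dT: "snd (crit0 (p - p')) = T p - T p'"
    by (simp_all add: S_def T_def linear_diff[OF linear_crit0])
  define u u' where "u = 2 *\<^sub>R S p - fst p - snd p" and "u' = 2 *\<^sub>R S p' - fst p' - snd p'"
  have mu: "2 *\<^sub>R ((1/2) *\<^sub>R (S p + S p')) - fst ((1/2) *\<^sub>R (p + p')) - snd ((1/2) *\<^sub>R (p + p')) = (1/2) *\<^sub>R (u + u')"
    by (simp add: u_def u'_def algebra_simps)
  have du: "2 *\<^sub>R (S p - S p') - fst (p - p') - snd (p - p') = u - u'"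
    by (simp add: u_def u'_def algebra_simps)
  have ml: "2 * Re (l ((1/2) *\<^sub>R (S p + S p'))) = Re (l (S p)) + Re (l (S p'))"
    by (simp add: l.scaleR l.add)
  \<comment> \<open>The five premises are the parallelogram identities for the two \<open>N\<close>
    terms and the two \<open>G\<close> terms, and linearity of \<open>l\<close>.\<close>
  have arith: "- (4 * t + n - 2 * (g + y) - 2 * h) / 2 + - (4 * t' + n' - 2 * (g' + y') - 2 * h') / 2
      = 2 * (- (4 * tm + nm - 2 * (gm + ym) - 2 * hm) / 2) - (4 * td + nd - 2 * gd - 2 * hd) / 2 / 2"
    if "t + t' = 2 * tm + td / 2" "n + n' = 2 * nm + nd / 2" "g + g' = 2 * gm + gd / 2"
      "h + h' = 2 * hm + hd / 2" "2 * ym = y + y'"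
    for t t' tm td n n' nm nd g g' gm gd h h' hm hd y y' ym :: real
    using that by (simp add: field_simps)
  show ?thesis
    unfolding k_eq q_def midS midT dS dT mu du u_def[symmetric] u'_def[symmetric] plus_complex.sel
    by (rule arith[OF parN[of "T p" "T p'"] parN[of u u'] parG[of "S p" "S p'"] parG[of "T p" "T p'"] ml])
qed

lemma q_nonneg: "0 \<le> q p"
  unfolding q_def
  using N_nonneg[of "snd (crit0 p)"] N_nonneg[of "2 *\<^sub>R fst (crit0 p) - fst p - snd p"]
    Re_G_nonpos[of "fst (crit0 p)"] Re_G_nonpos[of "snd (crit0 p)"]
  by simp

text \<open>All four summands of \<open>q\<close> are nonnegative, so each vanishes; definiteness of
  \<open>N\<close> then makes the critical point real and equal to the midpoint of x and w.\<close>

lemma q_eq_0_D: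
  assumes "q p = 0"
  shows "snd (crit0 p) = 0" "fst p + snd p = 2 *\<^sub>R fst (crit0 p)"
proof -
  have "4 * N (snd (crit0 p)) + N (2 *\<^sub>R fst (crit0 p) - fst p - snd p)
     - 2 * Re (G (fst (crit0 p)) (fst (crit0 p))) - 2 * Re (G (snd (crit0 p)) (snd (crit0 p))) = 0"
    using assms unfolding q_def by simp
  with N_nonneg[of "snd (crit0 p)"] N_nonneg[of "2 *\<^sub>R fst (crit0 p) - fst p - snd p"]
    Re_G_nonpos[of "fst (crit0 p)"] Re_G_nonpos[of "snd (crit0 p)"]
  have "N (snd (crit0 p)) = 0 \<and> N (2 *\<^sub>R fst (crit0 p) - fst p - snd p) = 0"
    by (intro conjI; linarith)
  then have "snd (crit0 p) = 0 \<and> 2 *\<^sub>R fst (crit0 p) - fst p - snd p = 0"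
    using N_pos[of "snd (crit0 p)"] N_pos[of "2 *\<^sub>R fst (crit0 p) - fst p - snd p"] by linarith
  then show "snd (crit0 p) = 0" "fst p + snd p = 2 *\<^sub>R fst (crit0 p)"
    by (simp_all add: diff_eq_eq add.commute)
qed

text \<open>At a zero the critical point \<open>s\<close> is real and \<open>w = 2 s\<close>, so the
  term \<open>H h w\<close> is \<open>2 * H h s\<close>, and the critical equation collapses to the
  first clause of \<open>nondeg\<close>. With x in place of w the same argument gives the second
  clause.\<close>

lemma q_right_pos:
  assumes "w \<noteq> 0" shows "0 < q (0, w)"
proof (rule ccontr)
  assume "\<not> 0 < q (0, w)"
  then have 0: "q (0, w) = 0" using q_nonneg[of "(0, w)"] by simp
  define s where "s = fst (crit0 (0, w))"
  have w: "w = 2 *\<^sub>R s" and t: "snd (crit0 (0, w)) = 0" using q_eq_0_D[OF 0] by (simp_all add: s_def)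
  have "G s h = H s h - H h s" for h
  proof -
    have "H h w = 2 * H h s" unfolding w H.scaleR_right by (simp add: scaleR_conv_of_real)
    then show ?thesis
      using crit0[of "(0, w)" h] unfolding t s_def[symmetric] A.zero_left
      by (simp add: H.zero_left A_def algebra_simps)
  qed
  then have "s = 0" by (rule nondeg)
  then show False using assms w by simp
qed

lemma q_left_pos:
  assumes "x \<noteq> 0" shows "0 < q (x, 0)"
proof (rule ccontr)
  assume "\<not> 0 < q (x, 0)"
  then have 0: "q (x, 0) = 0" using q_nonneg[of "(x, 0)"] by simp
  define s where "s = fst (crit0 (x, 0))"
  have x: "x = 2 *\<^sub>R s" and t: "snd (crit0 (x, 0)) = 0" using q_eq_0_D[OF 0] by (simp_all add: s_def)
  have "G s h = H h s - H s h" for h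
  proof -
    have "H x h = 2 * H s h" unfolding x H.scaleR_left by (simp add: scaleR_conv_of_real)
    then show ?thesis
      using crit0[of "(x, 0)" h] unfolding t s_def[symmetric] A.zero_left
      by (simp add: H.zero_right A_def algebra_simps)
  qed
  then have "s = 0" by (rule nondeg)
  then show False using assms x by simp
qed

lemma q_scaleR: "q (r *\<^sub>R p) = r\<^sup>2 * q p"
proof -
  have eq: "2 *\<^sub>R (r *\<^sub>R fst (crit0 p)) - r *\<^sub>R fst p - r *\<^sub>R snd p = r *\<^sub>R (2 *\<^sub>R fst (crit0 p) - fst p - snd p)"
    by (simp add: algebra_simps)
  show ?thesis
    unfolding q_def linear_scale[OF linear_crit0] fst_scaleR snd_scaleR eq N_scaleR
    by (simp add: G.scaleR_left G.scaleR_right power2_eq_square field_simps)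
qed

lemma continuous_on_q: "continuous_on UNIV q"
  unfolding q_def by (intro continuous_intros G.continuous_on) auto

section \<open>Uniform bounds for the rows and columns of the kernel\<close>

lemma schur_bounds:
  obtains C where "0 \<le> C" "\<And>x. (\<integral>\<^sup>+w. ennreal (exp (k (x, w))) \<partial>lborel) \<le> ennreal C"
    "\<And>w. (\<integral>\<^sup>+x. ennreal (exp (k (x, w))) \<partial>lborel) \<le> ennreal C"
proof -
  have "\<exists>c>0. \<forall>w. c * (norm w)\<^sup>2 \<le> q (0, w)"
  proof (rule quadratic_lower_bound)
    show "continuous_on UNIV (\<lambda>w. q (0, w))"
      by (rule continuous_on_compose2[OF continuous_on_q]) (auto intro!: continuous_on_Pair continuous_on_id continuous_on_const)
    fix r :: real and w :: "complex^'n"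
    have "(0::complex^'n, r *\<^sub>R w) = r *\<^sub>R (0, w)" by simp
    then show "q (0, r *\<^sub>R w) = r\<^sup>2 * q (0, w)" by (simp only: q_scaleR)
  qed (rule q_right_pos)
  then obtain c1 where c1: "c1 > 0" "\<And>w. c1 * (norm w)\<^sup>2 \<le> q (0, w)" by blast
  have "\<exists>c>0. \<forall>x. c * (norm x)\<^sup>2 \<le> q (x, 0)"
  proof (rule quadratic_lower_bound)
    show "continuous_on UNIV (\<lambda>x. q (x, 0))"
      by (rule continuous_on_compose2[OF continuous_on_q]) (auto intro!: continuous_on_Pair continuous_on_id continuous_on_const)
    fix r :: real and x :: "complex^'n"
    have "(r *\<^sub>R x, 0::complex^'n) = r *\<^sub>R (x, 0)" by simp
    then show "q (r *\<^sub>R x, 0) = r\<^sup>2 * q (x, 0)" by (simp only: q_scaleR)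
  qed (rule q_left_pos)
  then obtain c2 where c2: "c2 > 0" "\<And>x. c2 * (norm x)\<^sup>2 \<le> q (x, 0)" by blast
  \<comment> \<open>The half compensates the factor 1/2 in front of \<open>q\<close> in
    \<open>k_midpoint\<close>.\<close>
  define c where "c = min c1 c2 / 2"
  have c: "c > 0" using c1 c2 by (simp add: c_def)
  define g where "g x = exp (M + 1 - c * (norm (x::complex^'n))\<^sup>2)" for x
  have int: "integrable lborel g"
  proof -
    have "integrable lborel (\<lambda>x::complex^'n. exp (M + 1) * exp (- (c * (norm x)\<^sup>2)))"
      by (intro integrable_mult_right integrable_exp_neg_norm_square c)
    then show ?thesis unfolding g_def by (simp add: mult_exp_exp)
  qed
  have gC: "(\<integral>\<^sup>+x. ennreal (g x) \<partial>lborel) = ennreal (integral\<^sup>L lborel g)"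
    by (rule nn_integral_eq_integral[OF int]) (simp add: g_def)
  have cc1: "c * (norm w)\<^sup>2 \<le> q (0, w) / 2" and cc2: "c * (norm w)\<^sup>2 \<le> q (w, 0) / 2" for w
    using c1(2)[of w] c2(2)[of w] mult_right_mono[of "2 * c" c1 "(norm w)\<^sup>2"] mult_right_mono[of "2 * c" c2 "(norm w)\<^sup>2"]
    by (auto simp: c_def)
  show ?thesis
  proof
    show "0 \<le> integral\<^sup>L lborel g" by (simp add: g_def)
    show "(\<integral>\<^sup>+w. ennreal (exp (k (x, w))) \<partial>lborel) \<le> ennreal (integral\<^sup>L lborel g)" for x
      unfolding gC[symmetric] g_def
    proof (rule nn_integral_exp_concave_quadratic)
      fix w w' :: "complex^'n"
      have "(1/2) *\<^sub>R ((x, w) + (x, w')) = (x, (1/2) *\<^sub>R (w + w'))" by (simp add: scaleR_2[symmetric])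
      then show "k (x, w) + k (x, w') \<le> 2 * k (x, (1/2) *\<^sub>R (w + w')) - c * (norm (w - w'))\<^sup>2"
        using k_midpoint[of "(x, w)" "(x, w')"] cc1[of "w - w'"] by simp
    qed (rule k_le)
    show "(\<integral>\<^sup>+x. ennreal (exp (k (x, w))) \<partial>lborel) \<le> ennreal (integral\<^sup>L lborel g)" for w
      unfolding gC[symmetric] g_def
    proof (rule nn_integral_exp_concave_quadratic)
      fix x x' :: "complex^'n"
      have "(1/2) *\<^sub>R ((x, w) + (x', w)) = ((1/2) *\<^sub>R (x + x'), w)" by (simp add: scaleR_2[symmetric])
      then show "k (x, w) + k (x', w) \<le> 2 * k ((1/2) *\<^sub>R (x + x'), w) - c * (norm (x - x'))\<^sup>2"
        using k_midpoint[of "(x, w)" "(x', w)"] cc2[of "x - x'"] by simp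
    qed (rule k_le)
  qed
qed

end

section \<open>Gaussian symbols on the Fock space\<close>

text \<open>The parameter \<open>r\<close> covers both uses: 1 for a Gaussian in y - w, 0 for a
  plain product.\<close>

lemma integrable_mult_translate_pair:
  fixes f \<phi> :: "'a::euclidean_space \<Rightarrow> real"
  assumes f: "integrable lborel f" and \<phi>: "integrable lborel \<phi>"
    and fm: "f \<in> borel_measurable borel" and \<phi>m: "\<phi> \<in> borel_measurable borel"
  shows "integrable (lborel \<Otimes>\<^sub>M lborel) (\<lambda>(w, y). f w * \<phi> (y - r *\<^sub>R w))"
proof (rule lborel_pair.Fubini_integrable)
  have "(\<lambda>p::'a \<times> 'a. f (fst p) * \<phi> (snd p - r *\<^sub>R fst p)) \<in> borel_measurable (borel \<Otimes>\<^sub>M borel)"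
    using fm \<phi>m by measurable
  then show "(\<lambda>(w, y). f w * \<phi> (y - r *\<^sub>R w)) \<in> borel_measurable (lborel \<Otimes>\<^sub>M lborel)"
    by (simp only: borel_prod lborel_prod case_prod_unfold measurable_lborel2)
  have t: "integrable lborel (\<lambda>y. \<phi> (y - r *\<^sub>R w))" for w
    using integrable_lborel_affine[OF \<phi>m _ \<phi>, of 1 "- r *\<^sub>R w"] by simp
  show "AE w in lborel. integrable lborel (\<lambda>y. case (w, y) of (w, y) \<Rightarrow> f w * \<phi> (y - r *\<^sub>R w))"
    using t by simp
  have "(\<integral>y. norm (case (w, y) of (w, y) \<Rightarrow> f w * \<phi> (y - r *\<^sub>R w)) \<partial>lborel) = \<bar>f w\<bar> * (\<integral>y. \<bar>\<phi> y\<bar> \<partial>lborel)" for w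
  proof -
    have "(\<lambda>y. \<bar>\<phi> y\<bar>) \<in> borel_measurable borel" using \<phi>m by measurable
    from integral_lborel_affine[OF this, of 1 "- r *\<^sub>R w"] show ?thesis
      by (simp add: abs_mult)
  qed
  then show "integrable lborel (\<lambda>w. \<integral>y. norm (case (w, y) of (w, y) \<Rightarrow> f w * \<phi> (y - r *\<^sub>R w)) \<partial>lborel)"
    using f by simp
qed

context gaussian_symbol
begin

definition g :: "complex^'n \<Rightarrow> complex" where "g m = G m m + l m"

lemma Re_g_le: "Re (g m) \<le> M"
  using bnd by (simp add: g_def)

lemma continuous_on_g [continuous_intros]: "continuous_on U f \<Longrightarrow> continuous_on U (\<lambda>x. g (f x))"
  unfolding g_def by (intro continuous_intros G.continuous_on l.continuous_on)

text \<open>The Weyl operator after the gauge transformation, up to the constant factor and the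
  Jacobian, which is constant too.\<close>

definition gauss_op :: "(complex^'n \<Rightarrow> complex) \<Rightarrow> complex^'n \<Rightarrow> complex" where
  "gauss_op v x = (\<integral>y. exp (H (x - y) ((1/2) *\<^sub>R (x + y)) + g ((1/2) *\<^sub>R (x + y))) * v y \<partial>lborel)"

text \<open>The image under \<open>gauss_op\<close> of the reproducing kernel
  \<open>exp (H y w)\<close>, as a function of y.\<close>

definition kern :: "complex^'n \<Rightarrow> complex^'n \<Rightarrow> complex" where
  "kern x w = (\<integral>y. exp (H (x - y) ((1/2) *\<^sub>R (x + y)) + g ((1/2) *\<^sub>R (x + y)) + H y w) \<partial>lborel)"

text \<open>\<open>v y\<close> is replaced by its reproducing integral and the order of integration
  exchanged. Fubini applies because, for fixed x, the double integrand is dominated by the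
  integrable function of the hypothesis at w times a Gaussian in y - w.\<close>

lemma gauss_op_kern:
  assumes v: "holo_n v" and int: "integrable lborel (\<lambda>w. cmod (v w) * exp (- N w / 2))"
  shows "gauss_op v x * of_real Z = (\<integral>w. kern x w * (v w * exp (- of_real (N w))) \<partial>lborel)"
proof -
  define e where "e y = H (x - y) ((1/2) *\<^sub>R (x + y)) + g ((1/2) *\<^sub>R (x + y))" for y
  define F where "F w y = exp (e y + H y w) * (v w * exp (- of_real (N w)))" for w y
  have cv: "continuous_on U v" for U by (rule holo_n_continuous[OF v])
  \<comment> \<open>Midpoint quantisation makes the real part of the phase exactly the difference of
    half weights; only the symbol has to be estimated.\<close>
  have Re_e: "Re (e y) \<le> N x / 2 - N y / 2 + M" for y
  proof -
    have "Re (H (x - y) ((1/2) *\<^sub>R (x + y))) = (N x - N y) / 2"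
      by (simp add: H.scaleR_right H.diff_left H.add_right N_def Re_H_commute[of y x])
    then show ?thesis using Re_g_le[of "(1/2) *\<^sub>R (x + y)"] by (simp add: e_def diff_divide_distrib)
  qed
  have bound: "cmod (F w y) \<le> exp (M + N x / 2) * ((cmod (v w) * exp (- N w / 2)) * exp (- N (y - w) / 2))" for w y
  proof -
    have "Re (e y + H y w) - N w \<le> (M + N x / 2) + - N w / 2 + - N (y - w) / 2"
      using Re_e[of y] N_diff[of y w] by (simp add: field_simps)
    then have "exp (Re (e y + H y w) - N w) \<le> exp ((M + N x / 2) + - N w / 2 + - N (y - w) / 2)"
      by simp
    then have "exp (Re (e y + H y w) - N w) * cmod (v w) \<le> exp ((M + N x / 2) + - N w / 2 + - N (y - w) / 2) * cmod (v w)"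
      by (rule mult_right_mono) simp
    moreover have "exp (Re (e y + H y w) - N w) * cmod (v w) = cmod (F w y)"
      unfolding F_def norm_mult norm_exp_eq_Re uminus_complex.sel Re_complex_of_real diff_conv_add_uminus plus_complex.sel exp_add
      by (simp only: mult_ac)
    moreover have "exp ((M + N x / 2) + - N w / 2 + - N (y - w) / 2) * cmod (v w)
        = exp (M + N x / 2) * ((cmod (v w) * exp (- N w / 2)) * exp (- N (y - w) / 2))"
      unfolding exp_add by (simp only: mult_ac)
    ultimately show ?thesis by (simp only:)
  qed
  have int0: "integrable (lborel \<Otimes>\<^sub>M lborel) (\<lambda>(w, y). (cmod (v w) * exp (- N w / 2)) * exp (- N (y - 1 *\<^sub>R w) / 2))"
  proof (rule integrable_mult_translate_pair[OF int])
    show "integrable lborel (\<lambda>y. exp (- N y / 2))"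
      using integrable_exp_neg_N[of "1/2" 0] by simp
  qed (intro borel_measurable_continuous_onI continuous_intros cv; simp)+
  have Fint: "integrable (lborel \<Otimes>\<^sub>M lborel) (\<lambda>(w, y). F w y)"
  proof (rule Bochner_Integration.integrable_bound)
    show "integrable (lborel \<Otimes>\<^sub>M lborel) (\<lambda>p. exp (M + N x / 2) * (case p of (w, y) \<Rightarrow> (cmod (v w) * exp (- N w / 2)) * exp (- N (y - 1 *\<^sub>R w) / 2)))"
      by (rule integrable_mult_right) (rule int0)
    have cF: "continuous_on UNIV (\<lambda>p::(complex^'n) \<times> (complex^'n). F (fst p) (snd p))"
      unfolding F_def e_def
      by (intro continuous_intros continuous_on_compose2[OF cv[of UNIV] continuous_on_fst]) auto
    then show "(\<lambda>(w, y). F w y) \<in> borel_measurable (lborel \<Otimes>\<^sub>M lborel)"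
      using borel_measurable_continuous_onI[OF cF] by (simp add: lborel_prod case_prod_unfold)
    show "AE p in lborel \<Otimes>\<^sub>M lborel. norm (case p of (w, y) \<Rightarrow> F w y)
      \<le> norm (exp (M + N x / 2) * (case p of (w, y) \<Rightarrow> (cmod (v w) * exp (- N w / 2)) * exp (- N (y - 1 *\<^sub>R w) / 2)))"
    proof (rule AE_I2)
      fix p :: "(complex^'n) \<times> (complex^'n)"
      show "norm (case p of (w, y) \<Rightarrow> F w y)
        \<le> norm (exp (M + N x / 2) * (case p of (w, y) \<Rightarrow> (cmod (v w) * exp (- N w / 2)) * exp (- N (y - 1 *\<^sub>R w) / 2)))"
        using bound[of "fst p" "snd p"] by (simp add: case_prod_unfold)
    qed
  qed
  have "gauss_op v x * of_real Z = (\<integral>y. exp (e y) * v y * of_real Z \<partial>lborel)"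
    by (simp only: gauss_op_def e_def integral_mult_left_zero)
  also have "\<dots> = (\<integral>y. (\<integral>w. F w y \<partial>lborel) \<partial>lborel)"
  proof (rule Bochner_Integration.integral_cong[OF refl])
    fix y
    have "F w y = exp (e y) * (exp (H y w) * v w * exp (- of_real (N w)))" for w
      unfolding F_def exp_add by (simp only: mult_ac)
    then have "(\<integral>w. F w y \<partial>lborel) = exp (e y) * (\<integral>w. exp (H y w) * v w * exp (- of_real (N w)) \<partial>lborel)"
      by (simp only: integral_mult_right_zero)
    then show "exp (e y) * v y * of_real Z = (\<integral>w. F w y \<partial>lborel)"
      by (simp only: reproducing_formula(2)[OF v int]) (simp only: mult.assoc)
  qed
  also have "\<dots> = (\<integral>w. (\<integral>y. F w y \<partial>lborel) \<partial>lborel)"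
    by (rule lborel_pair.Fubini_integral[OF Fint])
  also have "\<dots> = (\<integral>w. kern x w * (v w * exp (- of_real (N w))) \<partial>lborel)"
    by (simp only: F_def kern_def e_def integral_mult_left_zero)
  finally show ?thesis .
qed

section \<open>Evaluation of the kernel and boundedness in the Fock norm\<close>

lemma kern_measurable:
  "(\<lambda>y. exp (H (x - y) ((1/2) *\<^sub>R (x + y)) + g ((1/2) *\<^sub>R (x + y)) + H y w)) \<in> borel_measurable borel"
  by (intro borel_measurable_continuous_onI continuous_intros)

text \<open>Jacobian of the substitution y = 2 m - x on a real space of dimension 2n.\<close>

definition c0 :: real where "c0 = 2 ^ DIM(complex^'n)"
definition I0 :: complex where "I0 = (\<integral>m. exp (A m m) \<partial>lborel)"

text \<open>In the midpoint variable the exponent becomes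
  \<open>- H x w + (A m m + b (x, w) m)\<close>, so that the completed square applies and the
  remaining integral \<open>I0\<close> is independent of x and w.\<close>

lemma kern_eq:
  "kern x w = of_real c0 * exp ((b (x, w) (S (x, w)) + \<i> * b (x, w) (T (x, w))) / 2 - H x w) * I0"
proof -
  obtain c where c: "complex_gaussian A c" using complex_gaussian_A by blast
  have "H (x - (- x + 2 *\<^sub>R m)) ((1/2) *\<^sub>R (x + (- x + 2 *\<^sub>R m))) + g ((1/2) *\<^sub>R (x + (- x + 2 *\<^sub>R m))) + H (- x + 2 *\<^sub>R m) w
    = - H x w + (A m m + b (x, w) m)" for m
  proof -
    have 1: "(1/2) *\<^sub>R (x + (- x + 2 *\<^sub>R m)) = m" by simp
    have 2: "x - (- x + 2 *\<^sub>R m) = 2 *\<^sub>R (x - m)" by (simp add: scaleR_2 algebra_simps)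
    show ?thesis
      unfolding 1 2 H.scaleR_left H.diff_left H.add_left H.minus_left g_def A_def b_def fst_conv snd_conv
      by (simp add: scaleR_conv_of_real algebra_simps)
  qed
  then have "exp (H (x - (- x + 2 *\<^sub>R m)) ((1/2) *\<^sub>R (x + (- x + 2 *\<^sub>R m))) + g ((1/2) *\<^sub>R (x + (- x + 2 *\<^sub>R m))) + H (- x + 2 *\<^sub>R m) w)
    = exp (- H x w) * exp (A m m + b (x, w) m)" for m
    by (simp only: exp_add)
  then have "kern x w = c0 *\<^sub>R (exp (- H x w) * (\<integral>m. exp (A m m + b (x, w) m) \<partial>lborel))"
    unfolding kern_def using integral_lborel_affine[OF kern_measurable, of 2 x w "- x"]
    by (simp only: integral_mult_right_zero c0_def) simp
  also have "(\<integral>m. exp (A m m + b (x, w) m) \<partial>lborel)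
      = exp ((b (x, w) (S (x, w)) + \<i> * b (x, w) (T (x, w))) / 2) * I0"
    unfolding I0_def by (rule complex_gaussian.gaussian_complete_square[OF c crit_eq bounded_linear_b])
  finally show ?thesis
    by (simp only: scaleR_conv_of_real diff_conv_add_uminus exp_add mult_ac)
qed

lemma norm_kern: "cmod (kern x w) = c0 * cmod I0 * exp (k (x, w) + N x / 2 + N w / 2)"
proof -
  have "c0 \<ge> 0" by (simp add: c0_def)
  moreover have "Re ((b (x, w) (S (x, w)) + \<i> * b (x, w) (T (x, w))) / 2 - H x w) = k (x, w) + N x / 2 + N w / 2"
    by (simp add: k_def)
  ultimately show ?thesis
    unfolding kern_eq norm_mult norm_exp_eq_Re by (simp only: norm_of_real abs_of_nonneg mult_ac)
qed

lemma gauss_op_pointwise: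
  assumes v: "holo_n v" and int: "integrable lborel (\<lambda>w. cmod (v w) * exp (- N w / 2))"
  shows "ennreal (cmod (gauss_op v x) * exp (- N x / 2))
    \<le> ennreal (c0 * cmod I0 / Z) * (\<integral>\<^sup>+w. ennreal (exp (k (x, w))) * ennreal (cmod (v w) * exp (- N w / 2)) \<partial>lborel)"
proof -
  have nz: "0 < Z" by (rule Z_pos)
  have c0: "0 \<le> c0" by (simp add: c0_def)
  have ck: "continuous_on UNIV (\<lambda>w. k (x, w))"
    by (rule continuous_on_compose2[OF continuous_on_k]) (auto intro!: continuous_on_Pair continuous_on_id continuous_on_const)
  have mk: "(\<lambda>w. ennreal (exp (k (x, w))) * ennreal (cmod (v w) * exp (- N w / 2))) \<in> borel_measurable lborel"
    using borel_measurable_continuous_onI[OF ck] holo_n_measurable[OF v]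
      borel_measurable_continuous_onI[OF continuous_on_N[OF continuous_on_id]]
    by measurable
  have "ennreal (cmod (gauss_op v x * of_real Z)) \<le> (\<integral>\<^sup>+w. ennreal (cmod (kern x w * (v w * exp (- of_real (N w))))) \<partial>lborel)"
  proof (cases "integrable lborel (\<lambda>w. kern x w * (v w * exp (- of_real (N w))))")
    case True
    then show ?thesis unfolding gauss_op_kern[OF v int] by (rule integral_norm_bound_ennreal)
  next
    \<comment> \<open>The Bochner integral of a non-integrable function is 0, so the bound is
      trivial here.\<close>
    case False
    then show ?thesis unfolding gauss_op_kern[OF v int] by (simp add: not_integrable_integral_eq)
  qed
  also have "\<dots> = (\<integral>\<^sup>+w. ennreal (c0 * cmod I0 * exp (N x / 2)) * (ennreal (exp (k (x, w))) * ennreal (cmod (v w) * exp (- N w / 2))) \<partial>lborel)"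
  proof (rule nn_integral_cong)
    fix w
    have "cmod (kern x w * (v w * exp (- of_real (N w))))
        = (c0 * cmod I0 * exp (N x / 2)) * (exp (k (x, w)) * (cmod (v w) * exp (- N w / 2)))"
    proof -
      have "exp (k (x, w) + N x / 2 + N w / 2) * exp (- N w) = exp (N x / 2) * exp (k (x, w)) * exp (- N w / 2)"
        by (simp add: mult_exp_exp)
      then have "c0 * cmod I0 * exp (k (x, w) + N x / 2 + N w / 2) * (cmod (v w) * exp (- N w))
          = c0 * cmod I0 * cmod (v w) * (exp (N x / 2) * exp (k (x, w)) * exp (- N w / 2))"
        by (metis (no_types, lifting) mult.assoc mult.commute)
      then show ?thesis
        unfolding norm_mult norm_kern norm_exp_eq_Re uminus_complex.sel Re_complex_of_real
        by (simp only: mult_ac)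
    qed
    then show "ennreal (cmod (kern x w * (v w * exp (- of_real (N w)))))
        = ennreal (c0 * cmod I0 * exp (N x / 2)) * (ennreal (exp (k (x, w))) * ennreal (cmod (v w) * exp (- N w / 2)))"
      by (simp only: ennreal_mult''[symmetric] mult_nonneg_nonneg c0 norm_ge_zero exp_ge_zero)
  qed
  also have "\<dots> = ennreal (c0 * cmod I0 * exp (N x / 2)) * (\<integral>\<^sup>+w. ennreal (exp (k (x, w))) * ennreal (cmod (v w) * exp (- N w / 2)) \<partial>lborel)"
    by (rule nn_integral_cmult[OF mk])
  finally have "ennreal (exp (- N x / 2) / Z) * ennreal (cmod (gauss_op v x * of_real Z))
      \<le> ennreal (exp (- N x / 2) / Z) * (ennreal (c0 * cmod I0 * exp (N x / 2)) * (\<integral>\<^sup>+w. ennreal (exp (k (x, w))) * ennreal (cmod (v w) * exp (- N w / 2)) \<partial>lborel))"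
    by (rule mult_left_mono) simp
  moreover have "ennreal (exp (- N x / 2) / Z) * ennreal (cmod (gauss_op v x * of_real Z)) = ennreal (cmod (gauss_op v x) * exp (- N x / 2))"
    using nz by (simp add: ennreal_mult''[symmetric] norm_mult)
  moreover have "ennreal (exp (- N x / 2) / Z) * ennreal (c0 * cmod I0 * exp (N x / 2)) = ennreal (c0 * cmod I0 / Z)"
  proof -
    have "exp (- N x / 2) / Z * (c0 * cmod I0 * exp (N x / 2)) = c0 * cmod I0 / Z * (exp (- N x / 2) * exp (N x / 2))"
      by simp
    also have "exp (- N x / 2) * exp (N x / 2) = 1" by (simp add: mult_exp_exp)
    finally show ?thesis using nz c0 by (simp add: ennreal_mult''[symmetric])
  qed
  ultimately show ?thesis by (simp add: mult.assoc[symmetric])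
qed

text \<open>Once the weight \<open>exp (- N / 2)\<close> is distributed to both sides, the pointwise
  estimate is an integral operator with kernel \<open>exp k\<close>, and Schur's test gives a
  constant independent of \<open>v\<close>.\<close>

lemma gauss_op_bound:
  "\<exists>K\<ge>0. \<forall>v. holo_n v \<longrightarrow> integrable lborel (\<lambda>w. cmod (v w) * exp (- N w / 2)) \<longrightarrow>
    (\<integral>\<^sup>+x. ennreal ((cmod (gauss_op v x))\<^sup>2 * exp (- N x)) \<partial>lborel)
      \<le> ennreal K * (\<integral>\<^sup>+w. ennreal ((cmod (v w))\<^sup>2 * exp (- N w)) \<partial>lborel)"
proof -
  obtain C where C: "0 \<le> C" "\<And>x. (\<integral>\<^sup>+w. ennreal (exp (k (x, w))) \<partial>lborel) \<le> ennreal C"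
    "\<And>w. (\<integral>\<^sup>+x. ennreal (exp (k (x, w))) \<partial>lborel) \<le> ennreal C"
    using schur_bounds by blast
  define c1 where "c1 = c0 * cmod I0 / Z"
  have c1: "0 \<le> c1" using Z_pos by (simp add: c1_def c0_def)
  have sq: "(ennreal (cmod z * exp (- r / 2)))\<^sup>2 = ennreal ((cmod z)\<^sup>2 * exp (- r))" for z :: complex and r
  proof -
    have "(exp (- r / 2))\<^sup>2 = exp (- r)" by (simp add: exp_double[symmetric])
    then show ?thesis by (simp add: ennreal_power power_mult_distrib)
  qed
  have "(\<integral>\<^sup>+x. ennreal ((cmod (gauss_op v x))\<^sup>2 * exp (- N x)) \<partial>lborel)
      \<le> ennreal (c1\<^sup>2 * (C * C)) * (\<integral>\<^sup>+w. ennreal ((cmod (v w))\<^sup>2 * exp (- N w)) \<partial>lborel)"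
    if v: "holo_n v" and int: "integrable lborel (\<lambda>w. cmod (v w) * exp (- N w / 2))" for v
  proof -
    define f where "f w = ennreal (cmod (v w) * exp (- N w / 2))" for w
    have fm: "f \<in> borel_measurable borel"
      unfolding f_def using holo_n_measurable[OF v]
        borel_measurable_continuous_onI[OF continuous_on_N[OF continuous_on_id]] by measurable
    have km: "(\<lambda>p. k (fst p, snd p)) \<in> borel_measurable borel"
      using borel_measurable_continuous_onI[OF continuous_on_k] by simp
    have Km: "(\<lambda>x. (\<integral>\<^sup>+w. ennreal (exp (k (x, w))) * f w \<partial>lborel)\<^sup>2) \<in> borel_measurable lborel"
    proof -
      have 1: "(\<lambda>p. ennreal (exp (k p))) \<in> borel_measurable borel"
        using borel_measurable_continuous_onI[OF continuous_on_k] by measurable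
      have "(\<lambda>p. f (snd p)) \<in> borel_measurable ((borel :: (complex^'n) measure) \<Otimes>\<^sub>M borel)"
        by (rule measurable_compose[OF measurable_snd fm])
      then have 2: "(\<lambda>p::(complex^'n) \<times> (complex^'n). f (snd p)) \<in> borel_measurable borel"
        by (simp only: borel_prod)
      have "(\<lambda>p. ennreal (exp (k p)) * f (snd p)) \<in> borel_measurable (lborel \<Otimes>\<^sub>M lborel)"
        using borel_measurable_times_ennreal[OF 1 2] by (simp add: lborel_prod)
      then have "(\<lambda>(x, w). ennreal (exp (k (x, w))) * f w) \<in> borel_measurable (lborel \<Otimes>\<^sub>M lborel)"
        by (simp add: case_prod_unfold)
      from lborel.borel_measurable_nn_integral[OF this] show ?thesis
        unfolding power2_eq_square by (intro borel_measurable_times_ennreal) simp_all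
    qed
    have "(\<integral>\<^sup>+x. ennreal ((cmod (gauss_op v x))\<^sup>2 * exp (- N x)) \<partial>lborel)
      \<le> (\<integral>\<^sup>+x. ennreal (c1\<^sup>2) * (\<integral>\<^sup>+w. ennreal (exp (k (x, w))) * f w \<partial>lborel)\<^sup>2 \<partial>lborel)"
    proof (rule nn_integral_mono)
      fix x
      have "(ennreal (cmod (gauss_op v x) * exp (- N x / 2)))\<^sup>2
         \<le> (ennreal c1 * (\<integral>\<^sup>+w. ennreal (exp (k (x, w))) * f w \<partial>lborel))\<^sup>2"
        using gauss_op_pointwise[OF v int, of x] unfolding c1_def[symmetric] f_def[symmetric]
        by (rule power_mono) simp
      then show "ennreal ((cmod (gauss_op v x))\<^sup>2 * exp (- N x))
        \<le> ennreal (c1\<^sup>2) * (\<integral>\<^sup>+w. ennreal (exp (k (x, w))) * f w \<partial>lborel)\<^sup>2"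
        unfolding sq power_mult_distrib by (simp add: ennreal_power c1)
    qed
    also have "\<dots> = ennreal (c1\<^sup>2) * (\<integral>\<^sup>+x. (\<integral>\<^sup>+w. ennreal (exp (k (x, w))) * f w \<partial>lborel)\<^sup>2 \<partial>lborel)"
      by (rule nn_integral_cmult[OF Km])
    also have "\<dots> \<le> ennreal (c1\<^sup>2) * (ennreal C * ennreal C * (\<integral>\<^sup>+w. (f w)\<^sup>2 \<partial>lborel))"
      by (rule mult_left_mono, rule schur_test[where k="\<lambda>x w. k (x, w)", OF km fm C(2) C(3)]) simp
    also have "\<dots> = ennreal (c1\<^sup>2 * (C * C)) * (\<integral>\<^sup>+w. ennreal ((cmod (v w))\<^sup>2 * exp (- N w)) \<partial>lborel)"
      unfolding f_def sq using C(1) by (simp add: ennreal_mult mult.assoc)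
    finally show ?thesis .
  qed
  moreover have "0 \<le> c1\<^sup>2 * (C * C)" using C(1) by simp
  ultimately show ?thesis by blast
qed

section \<open>Holomorphy of the image\<close>

lemma kern_eq_integral:
  "kern x w = of_real c0 * (\<integral>m. exp (2 * H x m) *
     exp (H m w - H w m + of_real (N w / 2 - 2 * N m) + g (m + (1/2) *\<^sub>R w)) \<partial>lborel)"
proof -
  \<comment> \<open>The substitution y = w - x + 2 m is chosen so that x occurs only in the entire
    factor \<open>exp (2 * H x m)\<close>; in particular the symbol is evaluated at m + w / 2, free
    of x.\<close>
  have "H (x - ((w - x) + 2 *\<^sub>R m)) ((1/2) *\<^sub>R (x + ((w - x) + 2 *\<^sub>R m))) + g ((1/2) *\<^sub>R (x + ((w - x) + 2 *\<^sub>R m))) + H ((w - x) + 2 *\<^sub>R m) w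
    = 2 * H x m + (H m w - H w m + of_real (N w / 2 - 2 * N m) + g (m + (1/2) *\<^sub>R w))" for m
  proof -
    have 1: "(1/2) *\<^sub>R (x + ((w - x) + 2 *\<^sub>R m)) = m + (1/2) *\<^sub>R w" by (simp add: algebra_simps)
    have 2: "x - ((w - x) + 2 *\<^sub>R m) = 2 *\<^sub>R (x - m) - w" by (simp add: scaleR_2 algebra_simps)
    have 3: "of_real (N w / 2 - 2 * N m) = H w w / 2 - 2 * H m m" by (simp add: H_self)
    show ?thesis
      unfolding 1 2 3 H.scaleR_left H.scaleR_right H.diff_left H.add_left H.add_right
      by (simp add: scaleR_conv_of_real field_simps)
  qed
  then have eq: "exp (H (x - ((w - x) + 2 *\<^sub>R m)) ((1/2) *\<^sub>R (x + ((w - x) + 2 *\<^sub>R m))) + g ((1/2) *\<^sub>R (x + ((w - x) + 2 *\<^sub>R m))) + H ((w - x) + 2 *\<^sub>R m) w)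
    = exp (2 * H x m) * exp (H m w - H w m + of_real (N w / 2 - 2 * N m) + g (m + (1/2) *\<^sub>R w))" for m
    by (simp only: exp_add)
  show ?thesis
    unfolding kern_def using integral_lborel_affine[OF kern_measurable, of 2 x w "w - x"]
    by (simp only: eq c0_def) (simp add: scaleR_conv_of_real)
qed

text \<open>\<open>gauss_op v\<close> is written as one integral over pairs (w, m) of
  \<open>exp (2 * H x m)\<close> times an x-free factor and differentiated under the integral; the
  derivative is complex linear because \<open>H\<close> is so in its first slot.\<close>

lemma holo_n_gauss_op:
  assumes v: "holo_n v" and int: "integrable lborel (\<lambda>w. cmod (v w) * exp (- N w / 2))"
  shows "holo_n (gauss_op v)"
proof -
  define \<Gamma> where "\<Gamma> p = exp (H (snd p) (fst p) - H (fst p) (snd p) + of_real (N (fst p) / 2 - 2 * N (snd p))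
      + g (snd p + (1/2) *\<^sub>R fst p)) * (v (fst p) * exp (- of_real (N (fst p))))" for p
  define f where "f w = cmod (v w) * exp (- N w / 2)" for w
  define L where "L = (lborel :: (complex^'n) measure) \<Otimes>\<^sub>M (lborel :: (complex^'n) measure)"
  have cv: "continuous_on U v" for U by (rule holo_n_continuous[OF v])
  have c\<Gamma>: "continuous_on UNIV \<Gamma>"
    unfolding \<Gamma>_def
    by (intro continuous_intros continuous_on_compose2[OF cv[of UNIV] continuous_on_fst]) auto
  have sL: "borel_measurable L = borel_measurable borel"
    by (simp add: L_def lborel_prod)
  have fm: "f \<in> borel_measurable borel"
    unfolding f_def by (intro borel_measurable_continuous_onI continuous_intros cv) simp
  \<comment> \<open>\<open>H m w - H w m\<close> is purely imaginary and drops out of the modulus;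
    the growth \<open>exp (N w / 2)\<close> is absorbed by \<open>exp (- N w)\<close>.\<close>
  have \<Gamma>_le: "cmod (\<Gamma> p) \<le> exp M * (f (fst p) * exp (- 2 * N (snd p)))" for p
  proof -
    define w m where "w = fst p" and "m = snd p"
    have "cmod (\<Gamma> p) = exp (Re (g (m + (1/2) *\<^sub>R w))) * exp (N w / 2 - 2 * N m) * exp (- N w) * cmod (v w)"
      unfolding \<Gamma>_def w_def[symmetric] m_def[symmetric] norm_mult norm_exp_eq_Re plus_complex.sel minus_complex.sel
        uminus_complex.sel Re_complex_of_real Re_H_commute[of m w] diff_self exp_add by simp
    also have "\<dots> = exp (Re (g (m + (1/2) *\<^sub>R w))) * (f w * exp (- 2 * N m))"
    proof -
      have "exp (N w / 2 - 2 * N m) * exp (- N w) = exp (- N w / 2) * exp (- 2 * N m)"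
        by (simp add: mult_exp_exp)
      then show ?thesis by (simp add: f_def mult.assoc)
    qed
    also have "\<dots> \<le> exp M * (f w * exp (- 2 * N m))"
      by (rule mult_right_mono) (simp_all add: Re_g_le f_def)
    finally show ?thesis by (simp add: w_def m_def)
  qed
  obtain K where K: "0 \<le> K" "\<And>x m. cmod (H x m) \<le> norm x * norm m * K"
    using H.nonneg_bounded by blast
  have intf: "integrable L (\<lambda>p. exp M * (f (fst p) * exp (a * norm (snd p) - 2 * N (snd p))))" for a
  proof -
    have "integrable L (\<lambda>(w, y). f w * exp (a * norm (y - 0 *\<^sub>R w) - 2 * N (y - 0 *\<^sub>R w)))"
      unfolding L_def
    proof (rule integrable_mult_translate_pair[where \<phi>="\<lambda>y. exp (a * norm y - 2 * N y)"])
      show "integrable lborel f" unfolding f_def by (rule int)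
      show "integrable lborel (\<lambda>y. exp (a * norm y - 2 * N y))" by (rule integrable_exp_neg_N) simp
      show "(\<lambda>y. exp (a * norm y - 2 * N y)) \<in> borel_measurable borel"
        by (intro borel_measurable_continuous_onI continuous_intros)
    qed (rule fm)
    then show ?thesis by (simp add: case_prod_unfold)
  qed
  have Hexp: "cmod (exp (2 * H x m)) \<le> exp (2 * K * R * norm m)" if "norm x \<le> R" for x m R
  proof -
    have "Re (H x m) \<le> norm x * norm m * K" using K(2) complex_Re_le_cmod order_trans by blast
    also have "\<dots> \<le> R * norm m * K" by (intro mult_right_mono that K) auto
    finally show ?thesis by (simp add: mult_ac)
  qed
  have bound: "cmod (exp (2 * H x (snd p)) * \<Gamma> p) \<le> exp M * (f (fst p) * exp (2 * K * R * norm (snd p) - 2 * N (snd p)))"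
    if "norm x \<le> R" for x p R
  proof -
    have "cmod (exp (2 * H x (snd p)) * \<Gamma> p) \<le> exp (2 * K * R * norm (snd p)) * (exp M * (f (fst p) * exp (- 2 * N (snd p))))"
      unfolding norm_mult by (intro mult_mono Hexp that \<Gamma>_le) auto
    also have "\<dots> = exp M * (f (fst p) * (exp (2 * K * R * norm (snd p)) * exp (- 2 * N (snd p))))"
      by (simp only: mult_ac)
    finally show ?thesis by (simp add: mult_exp_exp)
  qed
  have cF: "continuous_on UNIV (\<lambda>p. exp (2 * H x (snd p)) * \<Gamma> p)" for x
    by (intro continuous_intros c\<Gamma>)
  have intF: "integrable L (\<lambda>p. exp (2 * H x (snd p)) * \<Gamma> p)" for x
  proof (rule Bochner_Integration.integrable_bound[OF intf[of "2 * K * norm x"]])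
    show "(\<lambda>p. exp (2 * H x (snd p)) * \<Gamma> p) \<in> borel_measurable L"
      unfolding sL by (rule borel_measurable_continuous_onI[OF cF])
    show "AE p in L. norm (exp (2 * H x (snd p)) * \<Gamma> p) \<le> norm (exp M * (f (fst p) * exp (2 * K * norm x * norm (snd p) - 2 * N (snd p))))"
    proof (rule AE_I2)
      fix p show "norm (exp (2 * H x (snd p)) * \<Gamma> p) \<le> norm (exp M * (f (fst p) * exp (2 * K * norm x * norm (snd p) - 2 * N (snd p))))"
        using bound[OF order_refl, of x p] by simp
    qed
  qed
  have eq: "gauss_op v x = of_real (c0 / Z) * (\<integral>p. exp (2 * H x (snd p)) * \<Gamma> p \<partial>L)" for x
  proof -
    have "gauss_op v x * of_real Z = (\<integral>w. of_real c0 * (\<integral>m. exp (2 * H x (snd (w, m))) * \<Gamma> (w, m) \<partial>lborel) \<partial>lborel)"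
      unfolding gauss_op_kern[OF v int] kern_eq_integral \<Gamma>_def fst_conv snd_conv
      by (simp only: integral_mult_left_zero[symmetric] mult.assoc)
    also have "\<dots> = of_real c0 * (\<integral>p. exp (2 * H x (snd p)) * \<Gamma> p \<partial>L)"
      unfolding integral_mult_right_zero L_def
      by (rule arg_cong[OF lborel_pair.integral_fst'[OF intF[unfolded L_def]]])
    finally show ?thesis using Z_pos by (simp add: field_simps)
  qed
  have "holo_n (\<lambda>x. \<integral>p. exp (2 * H x (snd p)) * \<Gamma> p \<partial>L)"
  proof (rule holo_n_I[where D="\<lambda>x h. \<integral>p. 2 * H h (snd p) * (exp (2 * H x (snd p)) * \<Gamma> p) \<partial>L"])
    fix x0 :: "complex^'n"
    define R where "R = norm x0 + 1"
    have R: "norm x \<le> R" if "x \<in> ball x0 1" for x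
      using that norm_triangle_ineq2[of x x0] by (simp add: R_def dist_norm norm_minus_commute)
    show "((\<lambda>x. \<integral>p. exp (2 * H x (snd p)) * \<Gamma> p \<partial>L) has_derivative
        (\<lambda>h. \<integral>p. 2 * H h (snd p) * (exp (2 * H x0 (snd p)) * \<Gamma> p) \<partial>L)) (at x0)"
    proof (rule has_derivative_integral_dominated[where r=1 and
          B="\<lambda>p. exp M * (f (fst p) * exp ((2 * K + 2 * K * R) * norm (snd p) - 2 * N (snd p)))" and
          D="\<lambda>x p h. 2 * H h (snd p) * (exp (2 * H x (snd p)) * \<Gamma> p)"])
      show "integrable L (\<lambda>p. exp M * (f (fst p) * exp ((2 * K + 2 * K * R) * norm (snd p) - 2 * N (snd p))))"
        by (rule intf)
      show "(\<lambda>p. 2 * H h (snd p) * (exp (2 * H x0 (snd p)) * \<Gamma> p)) \<in> borel_measurable L" for h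
        unfolding sL by (intro borel_measurable_continuous_onI continuous_intros c\<Gamma>)
      fix x :: "complex^'n" and p :: "(complex^'n) \<times> (complex^'n)" assume x: "x \<in> ball x0 1"
      show "integrable L (\<lambda>p. exp (2 * H x (snd p)) * \<Gamma> p)" by (rule intF)
      show "((\<lambda>x. exp (2 * H x (snd p)) * \<Gamma> p) has_derivative (\<lambda>h. 2 * H h (snd p) * (exp (2 * H x (snd p)) * \<Gamma> p))) (at x)"
      proof -
        have "((\<lambda>x. 2 * H x (snd p)) has_derivative (\<lambda>h. 2 * H h (snd p))) (at x)"
          by (intro bounded_linear_imp_has_derivative bounded_linear_const_mult H.bounded_linear_left)
        from has_derivative_mult_left[OF has_derivative_compose[OF this, of exp "(*) (exp (2 * H x (snd p)))"], of "\<Gamma> p"]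
        show ?thesis using DERIV_exp[of "2 * H x (snd p)"] by (simp add: has_field_derivative_def mult_ac)
      qed
      fix h :: "complex^'n"
      have "cmod (2 * H h (snd p)) \<le> norm h * exp (2 * K * norm (snd p))"
      proof -
        have "cmod (2 * H h (snd p)) \<le> 2 * (norm h * norm (snd p) * K)" using K(2)[of h "snd p"] by (simp add: norm_mult)
        also have "\<dots> = norm h * (2 * K * norm (snd p))" by simp
        also have "\<dots> \<le> norm h * exp (2 * K * norm (snd p))"
          using exp_ge_add_one_self[of "2 * K * norm (snd p)"] by (intro mult_left_mono norm_ge_zero) linarith
        finally show ?thesis .
      qed
      then have "cmod (2 * H h (snd p) * (exp (2 * H x (snd p)) * \<Gamma> p))
        \<le> (norm h * exp (2 * K * norm (snd p))) * (exp M * (f (fst p) * exp (2 * K * R * norm (snd p) - 2 * N (snd p))))"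
        unfolding norm_mult[of "2 * H h (snd p)"] by (intro mult_mono bound R x) auto
      also have "\<dots> = exp M * (f (fst p) * (exp (2 * K * norm (snd p)) * exp (2 * K * R * norm (snd p) - 2 * N (snd p)))) * norm h"
        by (simp only: mult_ac)
      also have "exp (2 * K * norm (snd p)) * exp (2 * K * R * norm (snd p) - 2 * N (snd p))
          = exp ((2 * K + 2 * K * R) * norm (snd p) - 2 * N (snd p))"
        by (simp add: mult_exp_exp algebra_simps)
      finally show "norm (2 * H h (snd p) * (exp (2 * H x (snd p)) * \<Gamma> p))
        \<le> exp M * (f (fst p) * exp ((2 * K + 2 * K * R) * norm (snd p) - 2 * N (snd p))) * norm h" .
    qed simp
    fix h :: "complex^'n"
    have "2 * H (\<i> *s h) (snd p) * (exp (2 * H x0 (snd p)) * \<Gamma> p) = \<i> * (2 * H h (snd p) * (exp (2 * H x0 (snd p)) * \<Gamma> p))" for p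
      by (simp add: H_smult)
    then show "(\<integral>p. 2 * H (\<i> *s h) (snd p) * (exp (2 * H x0 (snd p)) * \<Gamma> p) \<partial>L)
        = \<i> * (\<integral>p. 2 * H h (snd p) * (exp (2 * H x0 (snd p)) * \<Gamma> p) \<partial>L)"
      by (simp only: integral_mult_right_zero)
  qed
  then have "holo_n (\<lambda>x. of_real (c0 / Z) * (\<integral>p. exp (2 * H x (snd p)) * \<Gamma> p \<partial>L))"
    by (intro holo_n_mult holo_n_const)
  then show ?thesis by (simp only: eq[symmetric])
qed

end

section \<open>Quadratic weights and their gradient graph\<close>

lemma bil_commute: "bil x y = bil y x"
  by (simp add: bil_def mult.commute)

lemma bil_add_left: "bil (x + y) z = bil x z + bil y z"
  and bil_add_right: "bil z (x + y) = bil z x + bil z y"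
  and bil_smult_left: "bil (c *s x) z = c * bil x z"
  and bil_smult_right: "bil z (c *s x) = c * bil z x"
  and bil_scaleR_left: "bil (r *\<^sub>R x) z = r *\<^sub>R bil x z"
  and bil_scaleR_right: "bil z (r *\<^sub>R x) = r *\<^sub>R bil z x"
  by (simp_all add: bil_def sum.distrib sum_distrib_left scaleR_sum_right algebra_simps)

lemma bounded_bilinear_bil: "bounded_bilinear (bil :: complex^'n \<Rightarrow> complex^'n \<Rightarrow> complex)"
proof -
  have "bilinear (bil :: complex^'n \<Rightarrow> complex^'n \<Rightarrow> complex)"
    unfolding bilinear_def
    by (auto intro!: linearI simp: bil_add_left bil_add_right bil_scaleR_left bil_scaleR_right)
  then show ?thesis by (simp add: bilinear_conv_bounded_bilinear)
qed

lemma bil_matrix_transpose: "bil x (A *v y) = bil y (transpose A *v x)"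
proof -
  have "bil x (A *v y) = (\<Sum>i\<in>UNIV. \<Sum>j\<in>UNIV. x $ i * (A $ i $ j * y $ j))"
    by (simp add: bil_def matrix_vector_mult_def sum_distrib_left)
  also have "\<dots> = (\<Sum>j\<in>UNIV. \<Sum>i\<in>UNIV. x $ i * (A $ i $ j * y $ j))"
    by (rule sum.swap)
  also have "\<dots> = bil y (transpose A *v x)"
    by (simp add: bil_def matrix_vector_mult_def transpose_def sum_distrib_left mult_ac)
  finally show ?thesis .
qed

lemma bil_nondegenerate:
  assumes "\<And>h. bil h x = 0" shows "x = 0"
proof -
  have "x $ k = 0" for k
  proof -
    have "bil (axis k 1) x = x $ k"
      by (simp add: bil_def axis_def if_distrib if_distribR cong: if_cong)
    then show ?thesis using assms[of "axis k 1"] by simp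
  qed
  then show ?thesis by (simp add: vec_eq_iff)
qed

lemma linear_matrix_vector: "linear (\<lambda>x::complex^'n. (A::complex^'n^'n) *v x)"
  by (rule linearI)
     (simp_all add: vec_eq_iff matrix_vector_mult_def sum.distrib scaleR_sum_right algebra_simps)

lemma smult_axis: "c *s axis k 1 = (axis k c :: complex^'n)"
  by (simp add: vec_eq_iff axis_def)

lemma i_smult_i_smult: "\<i> *s (\<i> *s x) = - (x :: complex^'n)"
  by (simp add: vec_eq_iff)

lemma i_smult_add: "\<i> *s (x + y) = \<i> *s x + \<i> *s (y :: complex^'n)"
  by (simp add: vec_eq_iff algebra_simps)

lemma i_smult_scaleR: "\<i> *s (r *\<^sub>R x) = r *\<^sub>R (\<i> *s (x :: complex^'n))"
  by (simp add: vec_eq_iff)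

locale real_quadratic =
  fixes Q :: "complex^'n \<Rightarrow> complex^'n \<Rightarrow> real"
  assumes bilQ: "bounded_bilinear Q"
    and Q_sym: "Q x y = Q y x"
begin

sublocale Q: bounded_bilinear Q by (rule bilQ)

abbreviation \<Phi> :: "complex^'n \<Rightarrow> real" where "\<Phi> x \<equiv> Q x x"

text \<open>\<open>E y x\<close> is \<open>2 \<Sum>\<^sub>k (\<partial>\<Phi>/\<partial>x\<^sub>k)(y) x\<^sub>k\<close>; as a function of \<open>y\<close> it splits into an antilinear part, the
  Levi form \<open>Hf\<close>, and a linear part \<open>P\<close>, whence \<open>2 \<Phi> = Hf + Re P\<close> on the diagonal.\<close>
definition E :: "complex^'n \<Rightarrow> complex^'n \<Rightarrow> complex" where
  "E y x = 2 * (of_real (Q y x) - \<i> * of_real (Q y (\<i> *s x)))"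

definition Hf :: "complex^'n \<Rightarrow> complex^'n \<Rightarrow> complex" where
  "Hf x y = (E y x + \<i> * E (\<i> *s y) x) / 2"

definition P :: "complex^'n \<Rightarrow> complex^'n \<Rightarrow> complex" where
  "P x y = (E y x - \<i> * E (\<i> *s y) x) / 2"

lemma E_eq: "E y x = Hf x y + P x y"
  by (simp add: Hf_def P_def field_simps)

lemma bilinear_E: "bilinear E"
  unfolding bilinear_def E_def
  by (intro conjI allI linearI)
     (simp_all add: Q.add_left Q.add_right Q.scaleR_left Q.scaleR_right i_smult_add i_smult_scaleR
       scaleR_conv_of_real[where 'a=complex] algebra_simps)

lemma E_linear: "linear (E y)" "linear (\<lambda>y. E y x)"
  using bilinear_E by (simp_all add: bilinear_def)

lemma E_add: "E y (x + x') = E y x + E y x'" "E (y + y') x = E y x + E y' x"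
  by (simp_all add: linear_add[OF E_linear(1)] linear_add[OF E_linear(2)])

lemma E_scaleR: "E y (r *\<^sub>R x) = r *\<^sub>R E y x" "E (r *\<^sub>R y) x = r *\<^sub>R E y x"
  by (simp_all add: linear_scale[OF E_linear(1)] linear_scale[OF E_linear(2)])

lemma E_smult: "E y (c *s x) = c * E y x"
proof (rule complex_linear_smult[OF E_linear(1)])
  show "E y (\<i> *s x) = \<i> * E y x" for x
    by (simp add: E_def i_smult_i_smult Q.minus_right algebra_simps)
qed

lemma P_smult_left: "P (c *s x) y = c * P x y" and Hf_smult_left: "Hf (c *s x) y = c * Hf x y"
  by (simp_all add: P_def Hf_def E_smult algebra_simps)

lemma P_sym: "P x y = P y x"
  by (simp add: P_def E_def i_smult_i_smult Q.minus_right Q_sym[of y x] Q_sym[of "\<i> *s y"] Q_sym[of y "\<i> *s x"] algebra_simps)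

lemma P_smult_right: "P x (c *s y) = c * P x y"
  by (metis P_sym P_smult_left)

lemma Hf_cnj: "Hf y x = cnj (Hf x y)"
  by (simp add: complex_eq_iff Hf_def E_def Q_sym[of y x] Q_sym[of "\<i> *s y"] Q_sym[of y "\<i> *s x"])

lemma bounded_bilinear_Hf: "bounded_bilinear Hf" and bounded_bilinear_P: "bounded_bilinear P"
proof -
  have "bilinear Hf"
    unfolding bilinear_def Hf_def
    by (intro conjI allI linearI)
       (simp_all add: E_add E_scaleR i_smult_add i_smult_scaleR scaleR_conv_of_real[where 'a=complex] field_simps)
  moreover have "bilinear P"
    unfolding bilinear_def P_def
    by (intro conjI allI linearI)
       (simp_all add: E_add E_scaleR i_smult_add i_smult_scaleR scaleR_conv_of_real[where 'a=complex] field_simps)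
  ultimately
  show "bounded_bilinear Hf" "bounded_bilinear P"
    by (simp_all add: bilinear_conv_bounded_bilinear)
qed

lemma two_Phi: "2 * \<Phi> x = Re (Hf x x) + Re (P x x)"
proof -
  have "E x x = Hf x x + P x x" by (rule E_eq)
  then have "Re (E x x) = Re (Hf x x) + Re (P x x)" by simp
  then show ?thesis by (simp add: E_def)
qed

section \<open>Complex derivatives of the weight, Levi form and contour\<close>

lemma has_derivative_Phi: "((\<lambda>z. complex_of_real (\<Phi> z)) has_derivative (\<lambda>h. of_real (2 * Q x h))) (at x)"
proof -
  have "(\<Phi> has_derivative (\<lambda>h. Q x h + Q h x)) (at x)"
    by (rule Q.FDERIV[OF has_derivative_ident has_derivative_ident])
  then have "((\<lambda>z. complex_of_real (\<Phi> z)) has_derivative (\<lambda>h. of_real (Q x h + Q h x))) (at x)"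
    by (rule has_derivative_of_real)
  then show ?thesis by (simp add: Q_sym[of _ x])
qed

lemma dz_Phi: "dz (\<lambda>z. complex_of_real (\<Phi> z)) x k = E x (axis k 1) / 2"
  unfolding dz_def frechet_derivative_at[OF has_derivative_Phi, symmetric] E_def smult_axis
  by (simp add: field_simps)

lemma dzbar_linear:
  assumes "bounded_linear f" shows "dzbar f x k = (f (axis k 1) + \<i> * f (axis k \<i>)) / 2"
  unfolding dzbar_def frechet_derivative_at[OF bounded_linear_imp_has_derivative[OF assms], symmetric] ..

lemma sum_axis: "(\<Sum>k\<in>UNIV. x $ k *s axis k 1) = (x :: complex^'n)"
  by (rule basis_expansion)

lemma E_sum: "(\<Sum>k\<in>UNIV. z $ k * E y (axis k 1)) = E y z"
proof -
  have "E y (\<Sum>k\<in>UNIV. z $ k *s axis k 1) = (\<Sum>k\<in>UNIV. E y (z $ k *s axis k 1))"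
    by (rule linear_sum[OF E_linear(1)])
  then show ?thesis by (simp add: sum_axis E_smult)
qed

text \<open>Links strict plurisubharmonicity to positivity of \<open>Hf\<close>; the factor 1/2
  reflects that \<open>Hf\<close> is the Levi form of twice the weight.\<close>

lemma Levi_form:
  "(\<Sum>j\<in>UNIV. \<Sum>k\<in>UNIV. dzbar (\<lambda>y. dz (\<lambda>z. complex_of_real (\<Phi> z)) y j) x k * w $ j * cnj (w $ k)) = Hf w w / 2"
proof -
  have "bounded_linear (\<lambda>y. E y (axis j 1) / 2)" for j
    by (intro linear_conv_bounded_linear[THEN iffD1] linearI)
       (simp_all add: E_add E_scaleR scaleR_conv_of_real[where 'a=complex] field_simps)
  then have d: "dzbar (\<lambda>y. dz (\<lambda>z. complex_of_real (\<Phi> z)) y j) x k = Hf (axis j 1) (axis k 1) / 2" for j k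
    unfolding dz_Phi by (subst dzbar_linear) (simp_all add: Hf_def smult_axis field_simps)
  have lin1: "linear (\<lambda>x. Hf x y)" and lin2: "linear (Hf x)" for x y
    using bounded_bilinear_Hf by (simp_all add: bilinear_conv_bounded_bilinear[symmetric] bilinear_def)
  have sr: "Hf x (c *s y) = cnj c * Hf x y" for x y c
    by (subst Hf_cnj) (simp add: Hf_smult_left Hf_cnj[symmetric])
  have "Hf w w = (\<Sum>j\<in>UNIV. Hf (w $ j *s axis j 1) w)"
    using linear_sum[OF lin1, of "\<lambda>j. w $ j *s axis j 1" UNIV w] by (simp only: sum_axis)
  also have "\<dots> = (\<Sum>j\<in>UNIV. \<Sum>k\<in>UNIV. Hf (w $ j *s axis j 1) (w $ k *s axis k 1))"
    using linear_sum[OF lin2, of _ "\<lambda>k. w $ k *s axis k 1" UNIV] by (simp only: sum_axis)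
  also have "\<dots> = (\<Sum>j\<in>UNIV. \<Sum>k\<in>UNIV. Hf (axis j 1) (axis k 1) * w $ j * cnj (w $ k))"
    by (simp only: Hf_smult_left sr mult_ac)
  finally show ?thesis by (simp add: d sum_divide_distrib)
qed

definition th :: "complex^'n \<Rightarrow> complex^'n" where
  "th y = (2 / \<i>) *s (\<chi> k. dz (\<lambda>z. complex_of_real (\<Phi> z)) y k)"

lemma th_nth: "th y $ k = - \<i> * E y (axis k 1)"
  by (simp add: th_def dz_Phi field_simps)

lemma linear_th: "linear th"
  by (rule linearI) (simp_all add: vec_eq_iff th_nth E_add E_scaleR scaleR_conv_of_real[where 'a=complex] algebra_simps)

text \<open>Turns the phase i (x - y) . theta of the Weyl integral into \<open>E m (x - y)\<close>
  at the midpoint m.\<close>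

lemma bil_th: "bil z (th y) = - \<i> * E y z"
proof -
  have "bil z (th y) = (\<Sum>k\<in>UNIV. (- \<i>) * (z $ k * E y (axis k 1)))"
    by (simp add: bil_def th_nth mult_ac)
  then show ?thesis by (simp only: sum_distrib_left[symmetric] E_sum)
qed

lemma lam_th: "lam \<Phi> x = (x, th x)"
  by (simp add: lam_def th_def)

lemma theta_th: "theta \<Phi> x y = th ((1/2) *\<^sub>R (x + y))"
  by (simp add: theta_def th_def)

text \<open>\<open>theta\<close> is affine in y with a linear part that does not depend on x, so its
  antiholomorphic derivatives are constant.\<close>

lemma contour_jac_const: "contour_jac \<Phi> x y = contour_jac \<Phi> 0 0"
proof -
  have der: "((\<lambda>z. theta \<Phi> x z $ j) has_derivative (\<lambda>h. th ((1/2) *\<^sub>R h) $ j)) (at y)" for x y j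
  proof -
    have "bounded_linear (\<lambda>h. th ((1/2) *\<^sub>R h) $ j)"
      by (intro linear_conv_bounded_linear[THEN iffD1] linearI)
         (simp_all add: linear_add[OF linear_th] linear_scale[OF linear_th] scaleR_add_right)
    then have "((\<lambda>h. th ((1/2) *\<^sub>R h) $ j) has_derivative (\<lambda>h. th ((1/2) *\<^sub>R h) $ j)) (at y)"
      by (rule bounded_linear_imp_has_derivative)
    then have "((\<lambda>z. th ((1/2) *\<^sub>R x) $ j + th ((1/2) *\<^sub>R z) $ j) has_derivative (\<lambda>h. th ((1/2) *\<^sub>R h) $ j)) (at y)"
      using has_derivative_add[OF has_derivative_const, of _ _ "at y" "th ((1/2) *\<^sub>R x) $ j"] by simp
    then show ?thesis
      by (simp add: theta_th scaleR_add_right linear_add[OF linear_th])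
  qed
  have "dzbar (\<lambda>z. theta \<Phi> x z $ j) y = dzbar (\<lambda>z. theta \<Phi> 0 z $ j) 0" for j
    unfolding dzbar_def frechet_derivative_at[OF der, symmetric] ..
  then show ?thesis unfolding contour_jac_def by (simp only:)
qed

end

section \<open>Boundedness of the Weyl quantization\<close>

text \<open>The set where the bound fails is open, and a nonempty open set is not null. Upgrades the
  essential bound on the symbol to a pointwise one.\<close>

lemma AE_le_imp_le:
  fixes f :: "'a::euclidean_space \<Rightarrow> real"
  assumes "continuous_on UNIV f" and ae: "AE x in lborel. f x \<le> K"
  shows "f x \<le> K"
proof (rule ccontr)
  assume "\<not> f x \<le> K"
  then have "x \<in> {x. K < f x}" by simp
  then have ne: "{x. K < f x} \<noteq> {}" by blast
  have op: "open {x. K < f x}"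
    using assms(1) by (intro open_Collect_less continuous_on_const)
  obtain B where "{x. \<not> f x \<le> K} \<subseteq> B" "B \<in> null_sets lborel"
    using ae by (auto simp: eventually_ae_filter)
  moreover have "B \<in> null_sets lebesgue" if "B \<in> null_sets lborel" for B :: "'a set"
    using that by (rule null_sets_completionI)
  ultimately have "negligible {x. K < f x}"
    using negligible_iff_null_sets negligible_subset[of B "{x. K < f x}"] by (auto simp: not_le)
  then show False using open_not_negligible[OF op ne] by blast
qed

lemma sum_UNIV_Plus:
  "(\<Sum>j\<in>(UNIV :: ('a::finite + 'b::finite) set). f j) = (\<Sum>j\<in>UNIV. f (Inl j)) + (\<Sum>j\<in>UNIV. f (Inr j))"
  by (subst UNIV_Plus_UNIV[symmetric], subst sum.Plus) auto

lemma fundamental_matrix_eigenvector: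
  fixes A B C :: "complex^'n^'n" and s t :: "complex^'n"
  assumes "transpose B *v s + C *v t = c *s s" "- (A *v s) - B *v t = c *s t" "s \<noteq> 0"
  shows "is_eigenvalue (fundamental_matrix A B C) c"
proof -
  define v :: "complex^('n + 'n)" where "v = (\<chi> i. case i of Inl p \<Rightarrow> s $ p | Inr p \<Rightarrow> t $ p)"
  have v: "v $ Inl p = s $ p" "v $ Inr p = t $ p" for p by (simp_all add: v_def)
  have "v \<noteq> 0"
  proof
    assume "v = 0"
    then have "s $ p = 0" for p using v(1)[of p] by simp
    then show False using assms(3) by (simp add: vec_eq_iff)
  qed
  moreover have "fundamental_matrix A B C *v v = c *s v"
  proof (rule vec_eq_iff[THEN iffD2], rule allI)
    fix i
    show "(fundamental_matrix A B C *v v) $ i = (c *s v) $ i"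
    proof (cases i)
      case (Inl p)
      have "(transpose B *v s + C *v t) $ p = c * s $ p" unfolding assms(1) by simp
      then show ?thesis
        by (simp add: Inl fundamental_matrix_def matrix_vector_mult_def sum_UNIV_Plus v
            del: transpose_matrix_vector)
    next
      case (Inr p)
      have "(- (A *v s) - B *v t) $ p = c * t $ p" unfolding assms(2) by simp
      then show ?thesis
        by (simp add: Inr fundamental_matrix_def matrix_vector_mult_def sum_UNIV_Plus v sum_negf)
    qed
  qed
  ultimately show ?thesis unfolding is_eigenvalue_def by blast
qed

section \<open>The symbol on the graph and the eigenvalue condition\<close>

context real_quadratic
begin

text \<open>Polarisation of i F (s, th s), where F is the quadratic form with Hessian blocks
  \<open>A\<close>, \<open>B\<close>, \<open>C\<close>. It is only real bilinear, because
  \<open>th\<close> is only real linear.\<close>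

definition symbol_form :: "complex^'n^'n \<Rightarrow> complex^'n^'n \<Rightarrow> complex^'n^'n \<Rightarrow> complex^'n \<Rightarrow> complex^'n \<Rightarrow> complex" where
  "symbol_form A B C s h = \<i> * (bil s (A *v h) + bil s (B *v th h) + bil h (B *v th s) + bil (th s) (C *v th h)) / 2"

lemma bounded_bilinear_symbol_form: "bounded_bilinear (symbol_form A B C)"
proof -
  have l: "(D *v (x + y)) = D *v x + D *v y" "(D *v (r *\<^sub>R x)) = r *\<^sub>R (D *v x)"
      "th (x + y) = th x + th y" "th (r *\<^sub>R x) = r *\<^sub>R th x"
    for D :: "complex^'n^'n" and x y and r :: real
    by (rule linear_add[OF linear_matrix_vector] linear_scale[OF linear_matrix_vector]
        linear_add[OF linear_th] linear_scale[OF linear_th])+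
  have "bilinear (symbol_form A B C)"
    unfolding bilinear_def symbol_form_def
    by (intro conjI allI linearI)
       (simp_all add: l bil_add_left bil_add_right bil_scaleR_left bil_scaleR_right
         scaleR_conv_of_real[where 'a=complex] field_simps)
  then show ?thesis by (simp add: bilinear_conv_bounded_bilinear)
qed

lemma symbol_form_sym:
  assumes "transpose A = A" "transpose C = C"
  shows "symbol_form A B C s h = symbol_form A B C h s"
  using bil_matrix_transpose[of s A h] bil_matrix_transpose[of "th s" C "th h"]
  by (simp add: symbol_form_def assms add_ac)

text \<open>The graph of \<open>th\<close> is totally real of maximal dimension, so a vector that is
  symplectically orthogonal to it vanishes.\<close>
lemma symplectic_orthogonal_graph:
  assumes pos: "\<And>x. x \<noteq> 0 \<Longrightarrow> 0 < Re (Hf x x)"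
    and orth: "\<And>h. bil h v2 = bil (th h) v1"
  shows "v1 = 0 \<and> v2 = 0"
proof -
  have o: "bil h v2 = - \<i> * E h v1" for h
    using orth[of h] bil_th[of v1 h] by (simp add: bil_commute)
  \<comment> \<open>In the orthogonality relation one side is complex linear in \<open>h\<close>,
    while \<open>E h v1\<close> has the antilinear part \<open>Hf v1 h\<close>; comparing
    \<open>h\<close> with \<open>\<i> *s h\<close> forces that part to vanish.\<close>
  have "Hf v1 h = 0" for h
  proof -
    have "\<i> * bil h v2 = - \<i> * E (\<i> *s h) v1"
      using o[of "\<i> *s h"] by (simp add: bil_smult_left)
    then have "\<i> * (- \<i> * E h v1) = - \<i> * E (\<i> *s h) v1" by (simp only: o)
    then have "E h v1 = - \<i> * E (\<i> *s h) v1" by simp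
    then show ?thesis by (simp add: Hf_def)
  qed
  then have "v1 = 0" using pos[of v1] by auto
  moreover from this have "bil h v2 = 0" for h
    using o[of h] linear_0[OF E_linear(1)] by simp
  then have "v2 = 0" by (rule bil_nondegenerate)
  ultimately show ?thesis by blast
qed

text \<open>The equation says that (fundamental matrix - 2 \<epsilon>) applied to (s, th s), which
  is (v1, v2), is symplectically orthogonal to the graph and so vanishes. The eigenvalue is 2
  \<epsilon> rather than \<epsilon> because \<open>symbol_form\<close> carries half the Hessian of
  F.\<close>

lemma symbol_form_nondegenerate:
  assumes symA: "transpose A = A" and symC: "transpose C = C"
    and pos: "\<And>x. x \<noteq> 0 \<Longrightarrow> 0 < Re (Hf x x)"
    and eig: "\<not> is_eigenvalue (fundamental_matrix A B C) (2 * \<epsilon>)"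
    and eq: "\<And>h. symbol_form A B C s h = \<epsilon> * (Hf s h - Hf h s)"
  shows "s = 0"
proof (rule ccontr)
  assume s: "s \<noteq> 0"
  define v1 where "v1 = transpose B *v s + C *v th s - (2 * \<epsilon>) *s s"
  define v2 where "v2 = - (A *v s) - B *v th s - (2 * \<epsilon>) *s th s"
  have orth: "bil h v2 = bil (th h) v1" for h
  proof -
    have diff: "bil x (y - z) = bil x y - bil x z" "bil x (- y) = - bil x y" for x y z :: "complex^'n"
      by (simp_all add: bounded_bilinear.diff_right[OF bounded_bilinear_bil] bounded_bilinear.minus_right[OF bounded_bilinear_bil])
    have 1: "bil h v2 = - bil h (A *v s) - bil h (B *v th s) - 2 * \<epsilon> * bil h (th s)"
      by (simp add: v2_def diff bil_smult_right)
    have 2: "bil (th h) v1 = bil (th h) (transpose B *v s) + bil (th h) (C *v th s) - 2 * \<epsilon> * bil s (th h)"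
      by (simp add: v1_def diff bil_add_right bil_smult_right bil_commute[of "th h" s])
    have 3: "bil s (A *v h) = bil h (A *v s)" "bil (th s) (C *v th h) = bil (th h) (C *v th s)"
      using bil_matrix_transpose[of s A h] bil_matrix_transpose[of "th s" C "th h"] by (simp_all add: symA symC)
    have 4: "bil s (B *v th h) = bil (th h) (transpose B *v s)"
      by (rule bil_matrix_transpose)
    \<comment> \<open>\<open>P\<close> is symmetric and cancels, so the symplectic form on the graph
      sees only the antisymmetric part of \<open>Hf\<close>.\<close>
    have 5: "bil s (th h) - bil h (th s) = - \<i> * (Hf s h - Hf h s)"
      unfolding bil_th E_eq P_sym[of s h] by (simp add: algebra_simps)
    have "\<i> * (bil (th h) v1 - bil h v2) / 2
        = \<i> * (bil s (A *v h) + bil s (B *v th h) + bil h (B *v th s) + bil (th s) (C *v th h)) / 2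
          - \<i> * \<epsilon> * (bil s (th h) - bil h (th s))"
      unfolding 1 2 3 4 by (simp add: field_simps)
    also have "\<dots> = symbol_form A B C s h - \<epsilon> * (Hf s h - Hf h s)"
    proof -
      have "\<i> * \<epsilon> * (- \<i> * z) = \<epsilon> * z" for z by (simp add: complex_eq_iff algebra_simps)
      then show ?thesis unfolding 5 symbol_form_def by (simp only:)
    qed
    also have "\<dots> = 0" by (simp add: eq)
    finally show ?thesis by simp
  qed
  have "v1 = 0 \<and> v2 = 0" by (rule symplectic_orthogonal_graph[OF pos orth])
  then have "transpose B *v s + C *v th s = (2 * \<epsilon>) *s s" "- (A *v s) - B *v th s = (2 * \<epsilon>) *s th s"
    by (simp_all add: v1_def v2_def)
  from fundamental_matrix_eigenvector[OF this s] eig show False by blast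
qed

end

section \<open>Transfer of the Fock space estimate to the Weyl operator\<close>

lemma weyl_bounded:
  fixes A B C :: "complex^'n^'n" and Q :: "complex^'n \<Rightarrow> complex^'n \<Rightarrow> real"
  assumes rq: "real_quadratic Q"
    and symA: "transpose A = A" and symC: "transpose C = C"
    and not2: "\<not> is_eigenvalue (fundamental_matrix A B C) 2"
    and notm2: "\<not> is_eigenvalue (fundamental_matrix A B C) (- 2)"
    and psh: "strictly_psh (\<lambda>x. Q x x)"
    and a: "\<And>x \<xi>. a (x, \<xi>) = exp (\<i> * ((bil x (A *v x) + 2 * bil x (B *v \<xi>) + bil \<xi> (C *v \<xi>)) / 2 + (bil c x + bil d \<xi>)))"
    and a_Linf: "AE x in lborel. cmod (a (lam (\<lambda>x. Q x x) x)) \<le> K0"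
  shows "\<exists>K. \<forall>u. weyl_dom (\<lambda>x. Q x x) u \<longrightarrow> H_space (\<lambda>x. Q x x) (weyl a (\<lambda>x. Q x x) u) \<and>
    H_norm (\<lambda>x. Q x x) (weyl a (\<lambda>x. Q x x) u) \<le> K * H_norm (\<lambda>x. Q x x) u"
proof -
  interpret real_quadratic Q by (rule rq)
  define l where "l x = \<i> * (bil c x + bil d (th x))" for x
  have linl: "bounded_linear l"
  proof -
    have "linear l"
      unfolding l_def
      by (rule linearI)
         (simp_all add: linear_add[OF linear_th] linear_scale[OF linear_th] bil_add_right bil_scaleR_right
           scaleR_conv_of_real[where 'a=complex] algebra_simps)
    then show ?thesis by (simp add: linear_conv_bounded_linear)
  qed
  have pos: "0 < Re (Hf x x)" if "x \<noteq> 0" for x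
    using psh that unfolding strictly_psh_def Levi_form by simp
  have a_th: "a (x, th x) = exp (symbol_form A B C x x + l x)" for x
    unfolding a symbol_form_def l_def by (simp add: field_simps)
  have contg: "continuous_on UNIV (\<lambda>x. symbol_form A B C x x + l x)"
    by (intro continuous_on_add bounded_bilinear.continuous_on[OF bounded_bilinear_symbol_form]
        linear_continuous_on[OF linl] continuous_on_id)
  have "cmod (a (x, th x)) \<le> K0" for x
  proof (rule AE_le_imp_le[where f="\<lambda>x. cmod (a (x, th x))"])
    show "continuous_on UNIV (\<lambda>x. cmod (a (x, th x)))"
      unfolding a_th by (intro continuous_on_norm continuous_on_exp contg)
    show "AE x in lborel. cmod (a (x, th x)) \<le> K0"
      using a_Linf by (simp add: lam_th)
  qed
  then have exp_le: "exp (Re (symbol_form A B C x x + l x)) \<le> K0" for x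
    by (simp add: a_th)
  \<comment> \<open>A bound on an exponential is positive, so its logarithm can serve as the upper
    bound on the exponent.\<close>
  then have "0 < K0" using exp_gt_zero less_le_trans by blast
  then have bnd: "Re (symbol_form A B C x x + l x) \<le> ln K0" for x
    using exp_le[of x] by (simp add: ln_ge_iff)
  interpret gs: gaussian_symbol Hf "symbol_form A B C" l "ln K0"
  proof (intro gaussian_symbol.intro hermitian_form.intro gaussian_symbol_axioms.intro)
    fix s
    show "s = 0" if "\<And>h. symbol_form A B C s h = Hf s h - Hf h s"
    proof (rule symbol_form_nondegenerate[OF symA symC pos])
      show "\<not> is_eigenvalue (fundamental_matrix A B C) (2 * 1)" using not2 by simp
      show "symbol_form A B C s h = 1 * (Hf s h - Hf h s)" for h by (simp add: that)
    qed
    show "s = 0" if "\<And>h. symbol_form A B C s h = Hf h s - Hf s h"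
    proof (rule symbol_form_nondegenerate[OF symA symC pos])
      show "\<not> is_eigenvalue (fundamental_matrix A B C) (2 * - 1)" using notm2 by simp
      show "symbol_form A B C s h = - 1 * (Hf s h - Hf h s)" for h by (simp add: that)
    qed
  qed (fact bounded_bilinear_Hf Hf_smult_left Hf_cnj pos bounded_bilinear_symbol_form linl bnd
        symbol_form_sym[OF symA symC])+
  define J where "J = contour_jac \<Phi> 0 0"
  define \<kappa> where "\<kappa> = complex_of_real ((1 / (2 * pi)) ^ CARD('n)) * J"
  \<comment> \<open>A holomorphic isometry onto the Fock space: by \<open>two_Phi\<close>, the
    modulus of the factor turns the weight \<open>exp (- N y / 2)\<close> into
    \<open>exp (- \<Phi> y)\<close>.\<close>
  define gauge where "gauge u = (\<lambda>y. u y * exp (- P y y / 2))" for u :: "complex^'n \<Rightarrow> complex"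
  have weyl_eq: "weyl a \<Phi> u x = \<kappa> * exp (P x x / 2) * gs.gauss_op (gauge u) x" for u x
  proof -
    have "exp (\<i> * bil (x - y) (theta \<Phi> x y)) * a ((1/2::real) *\<^sub>R (x + y), theta \<Phi> x y) * u y * contour_jac \<Phi> x y
      = (J * exp (P x x / 2)) * (exp (Hf (x - y) ((1/2) *\<^sub>R (x + y)) + gs.g ((1/2) *\<^sub>R (x + y))) * gauge u y)" for y
    proof -
      define m where "m = (1/2::real) *\<^sub>R (x + y)"
      \<comment> \<open>By symmetry of \<open>P\<close> the holomorphic part of the phase separates
        into a function of x and a function of y, which become the outer factor and the gauge
        factor.\<close>
      have "P (x - y) m = (P x x - P y y) / 2"
        unfolding m_def
        by (simp add: bounded_bilinear.scaleR_right[OF bounded_bilinear_P] bounded_bilinear.diff_left[OF bounded_bilinear_P]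
            bounded_bilinear.add_right[OF bounded_bilinear_P] P_sym[of y x] scaleR_conv_of_real[where 'a=complex])
      then have "\<i> * bil (x - y) (th m) = Hf (x - y) m + P x x / 2 + - P y y / 2"
        unfolding bil_th E_eq by (simp add: diff_divide_distrib)
      then have "exp (\<i> * bil (x - y) (th m)) = exp (Hf (x - y) m) * exp (P x x / 2) * exp (- P y y / 2)"
        by (simp only: exp_add)
      moreover have "a (m, th m) = exp (gs.g m)" by (simp add: a_th gs.g_def)
      ultimately show ?thesis
        unfolding theta_th m_def[symmetric] contour_jac_const[of x y] J_def[symmetric] gauge_def exp_add
        by (simp only: mult_ac)
    qed
    then show ?thesis
      unfolding weyl_def gs.gauss_op_def \<kappa>_def by (simp only: integral_mult_right_zero) (simp only: mult.assoc)
  qed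
  have N_Phi: "2 * \<Phi> x = gs.N x + Re (P x x)" for x
    by (simp add: two_Phi gs.N_def)
  have hP: "holo_n (\<lambda>x. P x x)"
    by (rule holo_n_quadratic[OF bounded_bilinear_P]) (simp_all add: P_smult_left P_smult_right)
  have hP': "holo_n (\<lambda>x. exp (c * P x x))" for c
    by (intro holo_n_exp holo_n_mult holo_n_const hP)
  have holo_gauge: "holo_n (gauge u)" if "holo_n u" for u
  proof -
    have "gauge u = (\<lambda>y. u y * exp ((- 1/2) * P y y))" by (simp add: gauge_def)
    then show ?thesis by (simp only: holo_n_mult[OF that hP'])
  qed
  have gauge1: "cmod (gauge u y) * exp (- gs.N y / 2) = cmod (u y) * exp (- \<Phi> y)" for u y
  proof -
    have "exp (- Re (P y y) / 2) * exp (- gs.N y / 2) = exp (- \<Phi> y)"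
      using N_Phi[of y] by (simp add: mult_exp_exp)
    then show ?thesis by (simp add: gauge_def norm_mult mult.assoc)
  qed
  have sq: "(c * exp (- r / 2))\<^sup>2 = c\<^sup>2 * exp (- r)" for c r :: real
    by (simp add: power_mult_distrib exp_double[symmetric])
  have gauge2: "(cmod (gauge u y))\<^sup>2 * exp (- gs.N y) = (cmod (u y))\<^sup>2 * exp (- 2 * \<Phi> y)" for u y
    using arg_cong[OF gauge1[of u y], of "\<lambda>z. z\<^sup>2"] sq[of "cmod (gauge u y)" "gs.N y"] sq[of "cmod (u y)" "2 * \<Phi> y"]
    by simp
  have weyl2: "(cmod (weyl a \<Phi> u x))\<^sup>2 * exp (- 2 * \<Phi> x)
      = (cmod \<kappa>)\<^sup>2 * ((cmod (gs.gauss_op (gauge u) x))\<^sup>2 * exp (- gs.N x))" for u x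
  proof -
    have "(exp (Re (P x x) / 2))\<^sup>2 * exp (- 2 * \<Phi> x) = exp (- gs.N x)"
      using N_Phi[of x] by (simp add: exp_double[symmetric] mult_exp_exp)
    then show ?thesis
      by (simp add: weyl_eq norm_mult power_mult_distrib mult_ac)
  qed
  obtain K where K: "0 \<le> K" "\<And>v. holo_n v \<Longrightarrow> integrable lborel (\<lambda>w. cmod (v w) * exp (- gs.N w / 2)) \<Longrightarrow>
      (\<integral>\<^sup>+x. ennreal ((cmod (gs.gauss_op v x))\<^sup>2 * exp (- gs.N x)) \<partial>lborel)
      \<le> ennreal K * (\<integral>\<^sup>+w. ennreal ((cmod (v w))\<^sup>2 * exp (- gs.N w)) \<partial>lborel)"
    using gs.gauss_op_bound by blast
  define K' where "K' = (cmod \<kappa>)\<^sup>2 * K"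
  have K': "0 \<le> K'" using K by (simp add: K'_def)
  show ?thesis
  proof (intro exI[of _ "sqrt K'"] allI impI)
    fix u assume "weyl_dom \<Phi> u"
    then have u: "holo_n u" and u2: "(\<integral>\<^sup>+x. ennreal ((cmod (u x))\<^sup>2 * exp (- 2 * \<Phi> x)) \<partial>lborel) < \<infinity>"
      and u1: "integrable lborel (\<lambda>y. cmod (u y) * exp (- \<Phi> y))"
      by (auto simp: weyl_dom_def H_space_def)
    have v1: "integrable lborel (\<lambda>y. cmod (gauge u y) * exp (- gs.N y / 2))"
      unfolding gauge1 by (rule u1)
    have hol: "holo_n (gs.gauss_op (gauge u))"
      by (rule gs.holo_n_gauss_op[OF holo_gauge[OF u] v1])
    have holw: "holo_n (weyl a \<Phi> u)"
    proof -
      have "weyl a \<Phi> u = (\<lambda>x. (\<kappa> * exp ((1/2) * P x x)) * gs.gauss_op (gauge u) x)"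
        by (simp add: weyl_eq fun_eq_iff)
      then show ?thesis
        by (simp only: holo_n_mult[OF holo_n_mult[OF holo_n_const hP'] hol])
    qed
    have gm: "(\<lambda>x. ennreal ((cmod (gs.gauss_op (gauge u) x))\<^sup>2 * exp (- gs.N x))) \<in> borel_measurable lborel"
      using holo_n_measurable[OF hol] borel_measurable_continuous_onI[OF gs.continuous_on_N[OF continuous_on_id]]
      by measurable
    have "(\<integral>\<^sup>+x. ennreal ((cmod (weyl a \<Phi> u x))\<^sup>2 * exp (- 2 * \<Phi> x)) \<partial>lborel)
      = (\<integral>\<^sup>+x. ennreal ((cmod \<kappa>)\<^sup>2) * ennreal ((cmod (gs.gauss_op (gauge u) x))\<^sup>2 * exp (- gs.N x)) \<partial>lborel)"
      unfolding weyl2 by (simp add: ennreal_mult')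
    also have "\<dots> = ennreal ((cmod \<kappa>)\<^sup>2) * (\<integral>\<^sup>+x. ennreal ((cmod (gs.gauss_op (gauge u) x))\<^sup>2 * exp (- gs.N x)) \<partial>lborel)"
      by (rule nn_integral_cmult[OF gm])
    also have "\<dots> \<le> ennreal ((cmod \<kappa>)\<^sup>2) * (ennreal K * (\<integral>\<^sup>+w. ennreal ((cmod (gauge u w))\<^sup>2 * exp (- gs.N w)) \<partial>lborel))"
      by (intro mult_left_mono K(2) holo_gauge u v1) simp
    also have "\<dots> = ennreal K' * (\<integral>\<^sup>+x. ennreal ((cmod (u x))\<^sup>2 * exp (- 2 * \<Phi> x)) \<partial>lborel)"
      unfolding gauge2 K'_def using K(1) by (simp add: ennreal_mult mult.assoc)
    finally have le: "(\<integral>\<^sup>+x. ennreal ((cmod (weyl a \<Phi> u x))\<^sup>2 * exp (- 2 * \<Phi> x)) \<partial>lborel)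
      \<le> ennreal K' * (\<integral>\<^sup>+x. ennreal ((cmod (u x))\<^sup>2 * exp (- 2 * \<Phi> x)) \<partial>lborel)" .
    \<comment> \<open>\<open>enn2real\<close> sends infinity to 0, so its monotonicity needs a
      finite right-hand side.\<close>
    have fin: "ennreal K' * (\<integral>\<^sup>+x. ennreal ((cmod (u x))\<^sup>2 * exp (- 2 * \<Phi> x)) \<partial>lborel) < top"
      using u2 by (simp add: ennreal_mult_less_top)
    have "enn2real (\<integral>\<^sup>+x. ennreal ((cmod (weyl a \<Phi> u x))\<^sup>2 * exp (- 2 * \<Phi> x)) \<partial>lborel)
      \<le> K' * enn2real (\<integral>\<^sup>+x. ennreal ((cmod (u x))\<^sup>2 * exp (- 2 * \<Phi> x)) \<partial>lborel)"
      using enn2real_mono[OF le fin] K' by (simp add: enn2real_mult)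
    then have "H_norm \<Phi> (weyl a \<Phi> u) \<le> sqrt K' * H_norm \<Phi> u"
      unfolding H_norm_def real_sqrt_mult[symmetric] by (rule real_sqrt_le_mono)
    moreover have "H_space \<Phi> (weyl a \<Phi> u)"
      unfolding H_space_def using holw le_less_trans[OF le fin] by simp
    ultimately show "H_space \<Phi> (weyl a \<Phi> u) \<and> H_norm \<Phi> (weyl a \<Phi> u) \<le> sqrt K' * H_norm \<Phi> u" by blast
  qed
qed

theorem theorem2p1:
  fixes A B C :: "complex^'n^'n"
    and F ell a :: "(complex^'n) \<times> (complex^'n) \<Rightarrow> complex"
    and \<Phi>0 :: "complex^'n \<Rightarrow> real"
  assumes symA: "transpose A = A" and symC: "transpose C = C"
    and F_quad: "\<forall>x \<xi>. F (x, \<xi>) = (bil x (A *v x) + 2 * bil x (B *v \<xi>) + bil \<xi> (C *v \<xi>)) / 2"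
    and not2: "\<not> is_eigenvalue (fundamental_matrix A B C) 2"
    and notm2: "\<not> is_eigenvalue (fundamental_matrix A B C) (- 2)"
    and l_lin: "\<exists>c d. \<forall>x \<xi>. ell (x, \<xi>) = bil c x + bil d \<xi>"
    and Phi_quad: "real_quadratic_form \<Phi>0"
    and Phi_psh: "strictly_psh \<Phi>0"
    and a_def: "\<forall>\<rho>. a \<rho> = exp (\<i> * (F \<rho> + ell \<rho>))"
    and a_Linf: "\<exists>M. AE x in lborel. cmod (a (lam \<Phi>0 x)) \<le> M"
  shows "\<exists>K. \<forall>u. weyl_dom \<Phi>0 u \<longrightarrow>
           H_space \<Phi>0 (weyl a \<Phi>0 u) \<and> H_norm \<Phi>0 (weyl a \<Phi>0 u) \<le> K * H_norm \<Phi>0 u"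
proof -
  obtain Q where Q: "bilinear Q" "\<And>x. \<Phi>0 x = Q x x"
    using Phi_quad unfolding real_quadratic_form_def by blast
  \<comment> \<open>Symmetrisation keeps the diagonal values and supplies the symmetry demanded by
    \<open>real_quadratic\<close>.\<close>
  define Qs where "Qs x y = (Q x y + Q y x) / 2" for x y
  have "bilinear Qs"
    unfolding bilinear_def Qs_def
    by (intro conjI allI linearI)
       (simp_all add: bilinear_ladd[OF Q(1)] bilinear_radd[OF Q(1)] bilinear_lmul[OF Q(1)] bilinear_rmul[OF Q(1)] field_simps)
  then have rq: "real_quadratic Qs"
    by (intro real_quadratic.intro) (simp_all add: bilinear_conv_bounded_bilinear Qs_def)
  have Phi: "\<Phi>0 = (\<lambda>x. Qs x x)" by (simp add: Qs_def Q(2) fun_eq_iff)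
  obtain c d where cd: "\<And>x \<xi>. ell (x, \<xi>) = bil c x + bil d \<xi>" using l_lin by blast
  obtain M where M: "AE x in lborel. cmod (a (lam \<Phi>0 x)) \<le> M" using a_Linf by blast
  have a: "a (x, \<xi>) = exp (\<i> * ((bil x (A *v x) + 2 * bil x (B *v \<xi>) + bil \<xi> (C *v \<xi>)) / 2 + (bil c x + bil d \<xi>)))" for x \<xi>
    using a_def F_quad cd by simp
  show ?thesis
    unfolding Phi
    by (rule weyl_bounded[OF rq symA symC not2 notm2 Phi_psh[unfolded Phi] a M[unfolded Phi]])
qed

end
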